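(* Let $R\in\mathcal{T}_n$ ($n>1$). Then $\mathcal{D}(R)$ satisfies each of the following conditions if and only if $R$ does so: (1) semilocal; (2) semiperfect; (3) left (or right) perfect; (4) semiprimary; (5) bounded index (of nilpotence).
   Context: All rings are associative with unity and modules are unital. An $n$-by-$n$ generalized matrix ring is a square array with rings $R_i$ on the diagonal and $(R_i,R_j)$-bimodules $M_{ij}$ in the $(i,j)$-positions ($i\neq j$, $M_{ii}=R_i$), together with $(R_i,R_k)$-bimodule homomorphisms $\theta_{ijk}:M_{ij}\otimes_{R_j}M_{jk}\to M_{ik}$, written $m_{ij}m_{jk}=\theta_{ijk}(m_{ij}\otimes m_{jk})$, satisfying $(m_{ij}m_{jk})m_{kl}=m_{ij}(m_{jk}m_{kl})$ for all indices; $\theta_{iii}$ is the multiplication of $R_i$, and $\theta_{ijj},\theta_{jjk}$ are the scalar multiplications. Addition is componentwise and multiplication is row-column matrix multiplication. For $n>1$, $\mathcal{T}_n$ is the class of $n$-by-$n$ generalized matrix rings with $\theta_{iji}=0$ for all $i\neq j$. $\mathcal{D}(R)=\{[r_{ij}]\in R\mid r_{ij}=0\text{ for all } i\neq j\}$. A ring has bounded index (of nilpotence) if there is a positive integer $k$ with $v^k=0$ for every nilpotent element $v$. *)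

theory Defs
  imports "HOL-Algebra.Module" "HOL-Algebra.QuotRing" "HOL-Algebra.Ideal_Product"
    "HOL-Algebra.Free_Abelian_Groups"
begin

section \<open>Bimodules and tensor products over noncommutative rings\<close>

text \<open>
  The library's \<^locale>\<open>module\<close> requires a commutative ring, so only its record is reused. As there,
  the fields \<^const>\<open>mult\<close> and \<^const>\<open>one\<close> inherited from the ring record carry no meaning for a
  bimodule.
\<close>

record ('r, 's, 'm) bimodule = "('r, 'm) module" +
  rsmult :: "['m, 's] \<Rightarrow> 'm" (infixl \<open>\<odot>\<^sub>r\<index>\<close> 70)

locale bimodule = R?: ring R + S?: ring S + M?: abelian_group M
  for R :: "('r, 'x) ring_scheme" and S :: "('s, 'y) ring_scheme"
    and M :: "('r, 's, 'm, 'z) bimodule_scheme" +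
  assumes smult_closed:
      "\<lbrakk>r \<in> carrier R; x \<in> carrier M\<rbrakk> \<Longrightarrow> r \<odot>\<^bsub>M\<^esub> x \<in> carrier M"
    and smult_l_distr:
      "\<lbrakk>r \<in> carrier R; r' \<in> carrier R; x \<in> carrier M\<rbrakk> \<Longrightarrow>
        (r \<oplus>\<^bsub>R\<^esub> r') \<odot>\<^bsub>M\<^esub> x = r \<odot>\<^bsub>M\<^esub> x \<oplus>\<^bsub>M\<^esub> r' \<odot>\<^bsub>M\<^esub> x"
    and smult_r_distr:
      "\<lbrakk>r \<in> carrier R; x \<in> carrier M; y \<in> carrier M\<rbrakk> \<Longrightarrow>
        r \<odot>\<^bsub>M\<^esub> (x \<oplus>\<^bsub>M\<^esub> y) = r \<odot>\<^bsub>M\<^esub> x \<oplus>\<^bsub>M\<^esub> r \<odot>\<^bsub>M\<^esub> y"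
    and smult_assoc:
      "\<lbrakk>r \<in> carrier R; r' \<in> carrier R; x \<in> carrier M\<rbrakk> \<Longrightarrow>
        (r \<otimes>\<^bsub>R\<^esub> r') \<odot>\<^bsub>M\<^esub> x = r \<odot>\<^bsub>M\<^esub> (r' \<odot>\<^bsub>M\<^esub> x)"
    and smult_one: "x \<in> carrier M \<Longrightarrow> \<one>\<^bsub>R\<^esub> \<odot>\<^bsub>M\<^esub> x = x"
    and rsmult_closed:
      "\<lbrakk>x \<in> carrier M; s \<in> carrier S\<rbrakk> \<Longrightarrow> x \<odot>\<^sub>r\<^bsub>M\<^esub> s \<in> carrier M"
    and rsmult_r_distr:
      "\<lbrakk>x \<in> carrier M; s \<in> carrier S; s' \<in> carrier S\<rbrakk> \<Longrightarrow>
        x \<odot>\<^sub>r\<^bsub>M\<^esub> (s \<oplus>\<^bsub>S\<^esub> s') = x \<odot>\<^sub>r\<^bsub>M\<^esub> s \<oplus>\<^bsub>M\<^esub> x \<odot>\<^sub>r\<^bsub>M\<^esub> s'"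
    and rsmult_l_distr:
      "\<lbrakk>x \<in> carrier M; y \<in> carrier M; s \<in> carrier S\<rbrakk> \<Longrightarrow>
        (x \<oplus>\<^bsub>M\<^esub> y) \<odot>\<^sub>r\<^bsub>M\<^esub> s = x \<odot>\<^sub>r\<^bsub>M\<^esub> s \<oplus>\<^bsub>M\<^esub> y \<odot>\<^sub>r\<^bsub>M\<^esub> s"
    and rsmult_assoc:
      "\<lbrakk>x \<in> carrier M; s \<in> carrier S; s' \<in> carrier S\<rbrakk> \<Longrightarrow>
        x \<odot>\<^sub>r\<^bsub>M\<^esub> (s \<otimes>\<^bsub>S\<^esub> s') = (x \<odot>\<^sub>r\<^bsub>M\<^esub> s) \<odot>\<^sub>r\<^bsub>M\<^esub> s'"
    and rsmult_one: "x \<in> carrier M \<Longrightarrow> x \<odot>\<^sub>r\<^bsub>M\<^esub> \<one>\<^bsub>S\<^esub> = x"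
    and smult_rsmult:
      "\<lbrakk>r \<in> carrier R; x \<in> carrier M; s \<in> carrier S\<rbrakk> \<Longrightarrow>
        (r \<odot>\<^bsub>M\<^esub> x) \<odot>\<^sub>r\<^bsub>M\<^esub> s = r \<odot>\<^bsub>M\<^esub> (x \<odot>\<^sub>r\<^bsub>M\<^esub> s)"

definition regular_bimodule :: "('a, 'x) ring_scheme \<Rightarrow> ('a, 'a, 'a) bimodule" where
  "regular_bimodule R =
    \<lparr>carrier = carrier R, mult = mult R, one = one R, ring.zero = ring.zero R, add = add R,
     smult = mult R, rsmult = mult R\<rparr>"

definition bimodule_hom ::
  "('r, 'x) ring_scheme \<Rightarrow> ('s, 'y) ring_scheme \<Rightarrow> ('r, 's, 'm, 'z) bimodule_scheme \<Rightarrow>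
   ('r, 's, 'n, 'w) bimodule_scheme \<Rightarrow> ('m \<Rightarrow> 'n) set" where
  "bimodule_hom R S M N =
    {h \<in> hom (add_monoid M) (add_monoid N).
       (\<forall>r\<in>carrier R. \<forall>x\<in>carrier M. h (r \<odot>\<^bsub>M\<^esub> x) = r \<odot>\<^bsub>N\<^esub> h x) \<and>
       (\<forall>x\<in>carrier M. \<forall>s\<in>carrier S. h (x \<odot>\<^sub>r\<^bsub>M\<^esub> s) = h x \<odot>\<^sub>r\<^bsub>N\<^esub> s)}"

definition tensor_relators ::
  "('s, 'y) ring_scheme \<Rightarrow> ('r, 's, 'm, 'z) bimodule_scheme \<Rightarrow> ('s, 't, 'n, 'w) bimodule_scheme
   \<Rightarrow> ('m \<times> 'n \<Rightarrow>\<^sub>0 int) set" where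
  "tensor_relators S M N =
    {frag_of (x \<oplus>\<^bsub>M\<^esub> x', y) - (frag_of (x, y) + frag_of (x', y)) | x x' y.
       x \<in> carrier M \<and> x' \<in> carrier M \<and> y \<in> carrier N} \<union>
    {frag_of (x, y \<oplus>\<^bsub>N\<^esub> y') - (frag_of (x, y) + frag_of (x, y')) | x y y'.
       x \<in> carrier M \<and> y \<in> carrier N \<and> y' \<in> carrier N} \<union>
    {frag_of (x \<odot>\<^sub>r\<^bsub>M\<^esub> s, y) - frag_of (x, s \<odot>\<^bsub>N\<^esub> y) | x s y.
       x \<in> carrier M \<and> s \<in> carrier S \<and> y \<in> carrier N}"

abbreviation tensor_free ::
  "('r, 's, 'm, 'z) bimodule_scheme \<Rightarrow> ('s, 't, 'n, 'w) bimodule_scheme \<Rightarrow> ('m \<times> 'n \<Rightarrow>\<^sub>0 int) monoid"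
  where "tensor_free M N \<equiv> free_Abelian_group (carrier M \<times> carrier N)"

definition tensor_kernel ::
  "('s, 'y) ring_scheme \<Rightarrow> ('r, 's, 'm, 'z) bimodule_scheme \<Rightarrow> ('s, 't, 'n, 'w) bimodule_scheme
   \<Rightarrow> ('m \<times> 'n \<Rightarrow>\<^sub>0 int) set" where
  "tensor_kernel S M N = generate (tensor_free M N) (tensor_relators S M N)"

text \<open>
  \<open>M \<otimes>\<^sub>S N\<close> is the free abelian group on pairs modulo the relators; its elements are cosets.
  The outer scalars act on a coset by acting on all its representatives, where a scalar acts on a
  formal combination of pairs through one component of each pair; the union below is a single
  coset, because the relators are mapped to relators.
\<close>

definition tensor_product ::
  "('s, 'y) ring_scheme \<Rightarrow> ('r, 's, 'm, 'z) bimodule_scheme \<Rightarrow> ('s, 't, 'n, 'w) bimodule_scheme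
   \<Rightarrow> ('r, 't, ('m \<times> 'n \<Rightarrow>\<^sub>0 int) set) bimodule" where
  "tensor_product S M N =
    (let F = tensor_free M N; K = tensor_kernel S M N; Q = F Mod K in
      \<lparr>carrier = carrier Q, mult = undefined, one = undefined, ring.zero = one Q, add = mult Q,
       smult = (\<lambda>r C. \<Union>u\<in>C. K #>\<^bsub>F\<^esub> frag_extend (\<lambda>(x, y). frag_of (r \<odot>\<^bsub>M\<^esub> x, y)) u),
       rsmult = (\<lambda>C t. \<Union>u\<in>C. K #>\<^bsub>F\<^esub> frag_extend (\<lambda>(x, y). frag_of (x, y \<odot>\<^sub>r\<^bsub>N\<^esub> t)) u)\<rparr>)"

definition pure_tensor ::
  "('s, 'y) ring_scheme \<Rightarrow> ('r, 's, 'm, 'z) bimodule_scheme \<Rightarrow> ('s, 't, 'n, 'w) bimodule_scheme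
   \<Rightarrow> 'm \<Rightarrow> 'n \<Rightarrow> ('m \<times> 'n \<Rightarrow>\<^sub>0 int) set" where
  "pure_tensor S M N x y = tensor_kernel S M N #>\<^bsub>tensor_free M N\<^esub> frag_of (x, y)"


section \<open>Generalized matrix rings\<close>

text \<open>
  All \<open>R\<^sub>i\<close> and \<open>M\<^sub>i\<^sub>j\<close> have their carriers in one type \<open>'a\<close>. This is no restriction, since types
  can be joined by sums and carriers are arbitrary subsets.
\<close>

definition entry_mult ::
  "(nat \<Rightarrow> 'a ring) \<Rightarrow> (nat \<Rightarrow> nat \<Rightarrow> ('a, 'a, 'a) bimodule) \<Rightarrow>
   (nat \<Rightarrow> nat \<Rightarrow> nat \<Rightarrow> ('a \<times> 'a \<Rightarrow>\<^sub>0 int) set \<Rightarrow> 'a) \<Rightarrow> nat \<Rightarrow> nat \<Rightarrow> nat \<Rightarrow> 'a \<Rightarrow> 'a \<Rightarrow> 'a" where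
  "entry_mult R M \<theta> i j k x y = \<theta> i j k (pure_tensor (R j) (M i j) (M j k) x y)"

locale generalized_matrix_ring =
  fixes n :: nat
    and R :: "nat \<Rightarrow> 'a ring"
    and M :: "nat \<Rightarrow> nat \<Rightarrow> ('a, 'a, 'a) bimodule"
    and \<theta> :: "nat \<Rightarrow> nat \<Rightarrow> nat \<Rightarrow> ('a \<times> 'a \<Rightarrow>\<^sub>0 int) set \<Rightarrow> 'a"
  assumes size_pos: "n \<ge> 1"
    and diagonal_ring: "i \<in> {1..n} \<Longrightarrow> ring (R i)"
    and diagonal_entry: "i \<in> {1..n} \<Longrightarrow> M i i = regular_bimodule (R i)"
    and entry_bimodule:
      "\<lbrakk>i \<in> {1..n}; j \<in> {1..n}; i \<noteq> j\<rbrakk> \<Longrightarrow> bimodule (R i) (R j) (M i j)"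
    and theta_hom:
      "\<lbrakk>i \<in> {1..n}; j \<in> {1..n}; k \<in> {1..n}\<rbrakk> \<Longrightarrow>
        \<theta> i j k \<in> bimodule_hom (R i) (R k) (tensor_product (R j) (M i j) (M j k)) (M i k)"
    and theta_iii:
      "\<lbrakk>i \<in> {1..n}; x \<in> carrier (R i); y \<in> carrier (R i)\<rbrakk> \<Longrightarrow>
        entry_mult R M \<theta> i i i x y = x \<otimes>\<^bsub>R i\<^esub> y"
    and theta_ijj:
      "\<lbrakk>i \<in> {1..n}; j \<in> {1..n}; x \<in> carrier (M i j); r \<in> carrier (R j)\<rbrakk> \<Longrightarrow>
        entry_mult R M \<theta> i j j x r = x \<odot>\<^sub>r\<^bsub>M i j\<^esub> r"
    and theta_jjk:
      "\<lbrakk>j \<in> {1..n}; k \<in> {1..n}; r \<in> carrier (R j); x \<in> carrier (M j k)\<rbrakk> \<Longrightarrow>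
        entry_mult R M \<theta> j j k r x = r \<odot>\<^bsub>M j k\<^esub> x"
    and entry_mult_assoc:
      "\<lbrakk>i \<in> {1..n}; j \<in> {1..n}; k \<in> {1..n}; l \<in> {1..n};
        x \<in> carrier (M i j); y \<in> carrier (M j k); z \<in> carrier (M k l)\<rbrakk> \<Longrightarrow>
        entry_mult R M \<theta> i k l (entry_mult R M \<theta> i j k x y) z =
        entry_mult R M \<theta> i j l x (entry_mult R M \<theta> j k l y z)"

definition gmat_ring ::
  "nat \<Rightarrow> (nat \<Rightarrow> 'a ring) \<Rightarrow> (nat \<Rightarrow> nat \<Rightarrow> ('a, 'a, 'a) bimodule) \<Rightarrow>
   (nat \<Rightarrow> nat \<Rightarrow> nat \<Rightarrow> ('a \<times> 'a \<Rightarrow>\<^sub>0 int) set \<Rightarrow> 'a) \<Rightarrow> (nat \<Rightarrow> nat \<Rightarrow> 'a) ring" where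
  "gmat_ring n R M \<theta> =
    \<lparr>carrier = (\<Pi>\<^sub>E i\<in>{1..n}. \<Pi>\<^sub>E j\<in>{1..n}. carrier (M i j)),
     mult = (\<lambda>A B. \<lambda>i\<in>{1..n}. \<lambda>k\<in>{1..n}.
       \<Oplus>\<^bsub>M i k\<^esub>j\<in>{1..n}. entry_mult R M \<theta> i j k (A i j) (B j k)),
     one = (\<lambda>i\<in>{1..n}. \<lambda>j\<in>{1..n}. if i = j then \<one>\<^bsub>R i\<^esub> else \<zero>\<^bsub>M i j\<^esub>),
     ring.zero = (\<lambda>i\<in>{1..n}. \<lambda>j\<in>{1..n}. \<zero>\<^bsub>M i j\<^esub>),
     add = (\<lambda>A B. \<lambda>i\<in>{1..n}. \<lambda>j\<in>{1..n}. A i j \<oplus>\<^bsub>M i j\<^esub> B i j)\<rparr>"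

text \<open>The class \<open>\<T>\<^sub>n\<close>, for \<open>n > 1\<close>.\<close>

locale class_T = generalized_matrix_ring +
  assumes size_gt_one: "n > 1"
    and trivial_theta:
      "\<lbrakk>i \<in> {1..n}; j \<in> {1..n}; i \<noteq> j; C \<in> carrier (tensor_product (R j) (M i j) (M j i))\<rbrakk> \<Longrightarrow>
        \<theta> i j i C = \<zero>\<^bsub>M i i\<^esub>"

definition diagonal_subring ::
  "nat \<Rightarrow> (nat \<Rightarrow> 'a ring) \<Rightarrow> (nat \<Rightarrow> nat \<Rightarrow> ('a, 'a, 'a) bimodule) \<Rightarrow>
   (nat \<Rightarrow> nat \<Rightarrow> nat \<Rightarrow> ('a \<times> 'a \<Rightarrow>\<^sub>0 int) set \<Rightarrow> 'a) \<Rightarrow> (nat \<Rightarrow> nat \<Rightarrow> 'a) ring" where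
  "diagonal_subring n R M \<theta> =
    (gmat_ring n R M \<theta>)
      \<lparr>carrier := {A \<in> carrier (gmat_ring n R M \<theta>).
         \<forall>i\<in>{1..n}. \<forall>j\<in>{1..n}. i \<noteq> j \<longrightarrow> A i j = \<zero>\<^bsub>M i j\<^esub>}\<rparr>"


section \<open>Ring-theoretic conditions\<close>

text \<open>The library's ideals are two-sided.\<close>

definition left_ideal :: "'a set \<Rightarrow> ('a, 'x) ring_scheme \<Rightarrow> bool" where
  "left_ideal I R \<longleftrightarrow>
    additive_subgroup I R \<and> (\<forall>r\<in>carrier R. \<forall>x\<in>I. r \<otimes>\<^bsub>R\<^esub> x \<in> I)"

definition maximal_left_ideal :: "'a set \<Rightarrow> ('a, 'x) ring_scheme \<Rightarrow> bool" where
  "maximal_left_ideal I R \<longleftrightarrow>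
    left_ideal I R \<and> I \<noteq> carrier R \<and>
    (\<forall>K. left_ideal K R \<and> I \<subseteq> K \<longrightarrow> K = I \<or> K = carrier R)"

text \<open>The intersection with the carrier matters only for the zero ring.\<close>

definition jacobson_radical :: "('a, 'x) ring_scheme \<Rightarrow> 'a set" where
  "jacobson_radical R = carrier R \<inter> \<Inter>{I. maximal_left_ideal I R}"

text \<open>
  Semisimplicity of the left regular module: every submodule, that is, every left ideal, is a
  direct summand.
\<close>

definition semisimple_ring :: "('a, 'x) ring_scheme \<Rightarrow> bool" where
  "semisimple_ring R \<longleftrightarrow>
    (\<forall>I. left_ideal I R \<longrightarrow>
      (\<exists>K. left_ideal K R \<and> I \<inter> K = {\<zero>\<^bsub>R\<^esub>} \<and> I <+>\<^bsub>R\<^esub> K = carrier R))"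

definition semilocal :: "('a, 'x) ring_scheme \<Rightarrow> bool" where
  "semilocal R \<longleftrightarrow> semisimple_ring (R Quot jacobson_radical R)"

definition idempotents_lift :: "('a, 'x) ring_scheme \<Rightarrow> 'a set \<Rightarrow> bool" where
  "idempotents_lift R I \<longleftrightarrow>
    (\<forall>C\<in>carrier (R Quot I). C \<otimes>\<^bsub>R Quot I\<^esub> C = C \<longrightarrow>
      (\<exists>e\<in>carrier R. e \<otimes>\<^bsub>R\<^esub> e = e \<and> I +>\<^bsub>R\<^esub> e = C))"

definition semiperfect :: "('a, 'x) ring_scheme \<Rightarrow> bool" where
  "semiperfect R \<longleftrightarrow> semilocal R \<and> idempotents_lift R (jacobson_radical R)"

text \<open>
  Left: \<open>a\<^sub>0 a\<^sub>1 \<dots> a\<^sub>m\<^sub>-\<^sub>1 = 0\<close> for some \<open>m \<ge> 1\<close>; right: \<open>a\<^sub>m\<^sub>-\<^sub>1 \<dots> a\<^sub>1 a\<^sub>0 = 0\<close>.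
\<close>

definition left_T_nilpotent :: "('a, 'x) ring_scheme \<Rightarrow> 'a set \<Rightarrow> bool" where
  "left_T_nilpotent R I \<longleftrightarrow>
    (\<forall>a :: nat \<Rightarrow> 'a. range a \<subseteq> I \<longrightarrow>
      (\<exists>m\<ge>1. foldr (mult R) (map a [0..<m]) \<one>\<^bsub>R\<^esub> = \<zero>\<^bsub>R\<^esub>))"

definition right_T_nilpotent :: "('a, 'x) ring_scheme \<Rightarrow> 'a set \<Rightarrow> bool" where
  "right_T_nilpotent R I \<longleftrightarrow>
    (\<forall>a :: nat \<Rightarrow> 'a. range a \<subseteq> I \<longrightarrow>
      (\<exists>m\<ge>1. foldr (mult R) (map a (rev [0..<m])) \<one>\<^bsub>R\<^esub> = \<zero>\<^bsub>R\<^esub>))"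

definition left_perfect :: "('a, 'x) ring_scheme \<Rightarrow> bool" where
  "left_perfect R \<longleftrightarrow> semilocal R \<and> left_T_nilpotent R (jacobson_radical R)"

definition right_perfect :: "('a, 'x) ring_scheme \<Rightarrow> bool" where
  "right_perfect R \<longleftrightarrow> semilocal R \<and> right_T_nilpotent R (jacobson_radical R)"

definition nilpotent_ideal :: "('a, 'x) ring_scheme \<Rightarrow> 'a set \<Rightarrow> bool" where
  "nilpotent_ideal R I \<longleftrightarrow>
    (\<exists>k\<ge>1. ((\<lambda>K. ideal_prod R K I) ^^ k) (carrier R) = {\<zero>\<^bsub>R\<^esub>})"

definition semiprimary :: "('a, 'x) ring_scheme \<Rightarrow> bool" where
  "semiprimary R \<longleftrightarrow> semilocal R \<and> nilpotent_ideal R (jacobson_radical R)"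

definition bounded_index :: "('a, 'x) ring_scheme \<Rightarrow> bool" where
  "bounded_index R \<longleftrightarrow>
    (\<exists>k::nat. k > 0 \<and>
      (\<forall>v\<in>carrier R. (\<exists>m::nat. v [^]\<^bsub>R\<^esub> m = \<zero>\<^bsub>R\<^esub>) \<longrightarrow> v [^]\<^bsub>R\<^esub> k = \<zero>\<^bsub>R\<^esub>))"

end

theory Submission
  imports Defs
begin

text \<open>
  Let \<open>R\<close> be the generalized matrix ring and \<open>D\<close> its subring of diagonal matrices. Since all products
  \<open>M\<^sub>i\<^sub>j M\<^sub>j\<^sub>i\<close> with \<open>i \<noteq> j\<close> vanish, the diagonal entries of a product of matrices are the products of the
  diagonal entries. Taking the diagonal is thus a ring homomorphism from \<open>R\<close> to \<open>D\<close> that fixes \<open>D\<close>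
  (\<open>diag_ring_hom\<close>). Its kernel \<open>N\<close> consists of the matrices with zero diagonal, and the product of any
  \<open>n\<close> elements of \<open>N\<close> is zero (\<open>off_diagonal_nilpotent\<close>): its entries are sums of products along paths
  with \<open>n\<close> edges between the \<open>n\<close> indices, each of these paths returns to some index \<open>i\<close>, and the
  factors between two visits of \<open>i\<close> have their product in \<open>M\<^sub>i\<^sub>j M\<^sub>j\<^sub>i = 0\<close>.

  The rest uses only that \<open>D\<close> is a retract of \<open>R\<close> with nilpotent kernel \<open>N\<close>
  (\<open>split_nilpotent_extension\<close>). A nil ideal lies in every maximal left ideal, so the Jacobson radical of
  \<open>R\<close> is the preimage of that of \<open>D\<close> (\<open>jacobson_radical_preimage\<close>). Hence the two rings have the same
  quotient modulo the radical and are semilocal together. Idempotents lift modulo one radical if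
  they lift modulo the other, as idempotents of \<open>D\<close> are idempotents of \<open>R\<close>. For the conditions about
  vanishing products, a product that vanishes in \<open>D\<close> lies in \<open>N\<close> when it is formed in \<open>R\<close>, and \<open>n\<close> such
  products in a row give zero. In the other direction these conditions pass from \<open>R\<close> to \<open>D\<close> because \<open>D\<close>
  is both a subring and an image of \<open>R\<close>.
\<close>

section \<open>Products of lists\<close>

abbreviation list_prod :: "('a, 'x) monoid_scheme \<Rightarrow> 'a list \<Rightarrow> 'a" where
  "list_prod R xs \<equiv> foldr (mult R) xs \<one>\<^bsub>R\<^esub>"

context monoid
begin

lemma list_prod_closed:
  "set xs \<subseteq> carrier G \<Longrightarrow> list_prod G xs \<in> carrier G"
  by (induction xs) auto

lemma list_prod_append:
  "set xs \<subseteq> carrier G \<Longrightarrow> set ys \<subseteq> carrier G \<Longrightarrow>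
    list_prod G (xs @ ys) = list_prod G xs \<otimes> list_prod G ys"
  by (induction xs) (auto simp: list_prod_closed m_assoc)

lemma list_prod_replicate:
  "x \<in> carrier G \<Longrightarrow> list_prod G (replicate k x) = x [^] k"
proof (induction k)
  case (Suc k)
  then show ?case
    using nat_pow_Suc2[of x k] by simp
qed simp

end

lemma (in ring_hom_ring) hom_list_prod:
  "set xs \<subseteq> carrier R \<Longrightarrow> h (list_prod R xs) = list_prod S (map h xs)"
  by (induction xs) (auto simp: R.list_prod_closed)

section \<open>Left ideals and the Jacobson radical\<close>

lemma jacobson_radical_subset: "jacobson_radical R \<subseteq> carrier R"
  by (simp add: jacobson_radical_def)

context ring
begin

lemma left_idealI:
  assumes "I \<subseteq> carrier R" "\<zero> \<in> I"
    and add: "\<And>x y. x \<in> I \<Longrightarrow> y \<in> I \<Longrightarrow> x \<oplus> y \<in> I"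
    and mult: "\<And>r x. r \<in> carrier R \<Longrightarrow> x \<in> I \<Longrightarrow> r \<otimes> x \<in> I"
  shows "left_ideal I R"
proof -
  have "\<ominus> x \<in> I" if "x \<in> I" for x
    using mult[of "\<ominus> \<one>" x] that assms(1) by (auto simp: l_minus)
  then have "subgroup I (add_monoid R)"
    using assms by unfold_locales (auto simp: a_inv_def[symmetric])
  then show ?thesis
    by (simp add: left_ideal_def additive_subgroupI mult)
qed

lemma left_idealD:
  assumes "left_ideal I R"
  shows left_ideal_subset: "I \<subseteq> carrier R"
    and left_ideal_zero: "\<zero> \<in> I"
    and left_ideal_add: "x \<in> I \<Longrightarrow> y \<in> I \<Longrightarrow> x \<oplus> y \<in> I"
    and left_ideal_mult: "r \<in> carrier R \<Longrightarrow> x \<in> I \<Longrightarrow> r \<otimes> x \<in> I"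
proof -
  interpret additive_subgroup I R
    using assms by (simp add: left_ideal_def)
  show "I \<subseteq> carrier R" "\<zero> \<in> I" "x \<in> I \<Longrightarrow> y \<in> I \<Longrightarrow> x \<oplus> y \<in> I"
    using a_subset by auto
  show "r \<in> carrier R \<Longrightarrow> x \<in> I \<Longrightarrow> r \<otimes> x \<in> I"
    using assms by (simp add: left_ideal_def)
qed

lemma left_ideal_one_imp_carrier:
  assumes "left_ideal I R" "\<one> \<in> I"
  shows "I = carrier R"
  using left_ideal_subset[OF assms(1)] left_ideal_mult[OF assms(1) _ assms(2)] by fastforce

lemma ideal_imp_left_ideal: "ideal I R \<Longrightarrow> left_ideal I R"
  by (simp add: left_ideal_def ideal.axioms(1) ideal.I_l_closed)

lemma set_add_iff: "x \<in> A <+>\<^bsub>R\<^esub> B \<longleftrightarrow> (\<exists>a\<in>A. \<exists>b\<in>B. x = a \<oplus> b)"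
  by (auto simp: set_add_def')

lemma left_ideal_set_add:
  assumes I: "left_ideal I R" and K: "left_ideal K R"
  shows "left_ideal (I <+>\<^bsub>R\<^esub> K) R"
proof (rule left_idealI)
  note sub = subsetD[OF left_ideal_subset[OF I]] subsetD[OF left_ideal_subset[OF K]]
  show "I <+>\<^bsub>R\<^esub> K \<subseteq> carrier R"
    using sub by (auto simp: set_add_iff)
  show "\<zero> \<in> I <+>\<^bsub>R\<^esub> K"
    using left_ideal_zero[OF I] left_ideal_zero[OF K] by (force simp: set_add_iff)
  fix x
  assume x: "x \<in> I <+>\<^bsub>R\<^esub> K"
  then obtain i k where ik: "i \<in> I" "k \<in> K" "x = i \<oplus> k"
    by (auto simp: set_add_iff)
  {
    fix y
    assume "y \<in> I <+>\<^bsub>R\<^esub> K"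
    then obtain i' k' where "i' \<in> I" "k' \<in> K" "y = i' \<oplus> k'"
      by (auto simp: set_add_iff)
    moreover have "(i \<oplus> k) \<oplus> (i' \<oplus> k') = (i \<oplus> i') \<oplus> (k \<oplus> k')"
      using ik sub calculation by (simp add: a_ac)
    ultimately show "x \<oplus> y \<in> I <+>\<^bsub>R\<^esub> K"
      using ik left_ideal_add[OF I] left_ideal_add[OF K] unfolding set_add_iff by metis
  next
    fix r
    assume "r \<in> carrier R"
    then have "r \<otimes> x = r \<otimes> i \<oplus> r \<otimes> k" "r \<otimes> i \<in> I" "r \<otimes> k \<in> K"
      using ik sub left_ideal_mult[OF I] left_ideal_mult[OF K] by (auto simp: r_distr)
    then show "r \<otimes> x \<in> I <+>\<^bsub>R\<^esub> K"
      unfolding set_add_iff by blast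
  }
qed

lemma left_ideal_subset_set_add:
  assumes I: "left_ideal I R" and K: "left_ideal K R"
  shows "I \<subseteq> I <+>\<^bsub>R\<^esub> K" "K \<subseteq> I <+>\<^bsub>R\<^esub> K"
proof -
  note sub = subsetD[OF left_ideal_subset[OF I]] subsetD[OF left_ideal_subset[OF K]]
  show "I \<subseteq> I <+>\<^bsub>R\<^esub> K"
    using sub left_ideal_zero[OF K] unfolding set_add_iff subset_iff by (metis r_zero)
  show "K \<subseteq> I <+>\<^bsub>R\<^esub> K"
    using sub left_ideal_zero[OF I] unfolding set_add_iff subset_iff by (metis l_zero)
qed

lemma jacobson_radical_left_ideal: "left_ideal (jacobson_radical R) R"
  by (rule left_idealI)
    (auto simp: jacobson_radical_def maximal_left_ideal_def
      intro: left_ideal_zero left_ideal_add left_ideal_mult)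

text \<open>
  For \<open>r \<notin> I\<close>, the map \<open>y \<mapsto> y r + I\<close> from \<open>R\<close> to the simple module \<open>R / I\<close> is nonzero, hence onto, and
  its kernel is the left ideal in question.
\<close>

lemma maximal_left_ideal_conductor:
  assumes I: "maximal_left_ideal I R" and r: "r \<in> carrier R" "r \<notin> I"
  shows "maximal_left_ideal {y \<in> carrier R. y \<otimes> r \<in> I} R" (is "maximal_left_ideal ?C R")
proof -
  have lI: "left_ideal I R"
    and max: "\<And>K. left_ideal K R \<Longrightarrow> I \<subseteq> K \<Longrightarrow> K = I \<or> K = carrier R"
    using I by (auto simp: maximal_left_ideal_def)
  have lC: "left_ideal ?C R"
    by (rule left_idealI)
      (use r lI in \<open>auto simp: l_distr m_assoc left_ideal_zero left_ideal_add left_ideal_mult\<close>)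
  have "K = carrier R" if lK: "left_ideal K R" and sub: "?C \<subseteq> K" and ne: "K \<noteq> ?C" for K
  proof -
    note Kc = subsetD[OF left_ideal_subset[OF lK]]
    obtain y where y: "y \<in> K" "y \<in> carrier R" "y \<otimes> r \<notin> I"
      using sub ne Kc by auto
    let ?L = "{s \<otimes> (y \<otimes> r) | s. s \<in> carrier R}"
    \<comment> \<open>The left ideal \<open>R y r\<close> is not inside \<open>I\<close>, so \<open>I + R y r = R\<close> contains \<open>r = i + s y r\<close>; then
        \<open>1 - s y\<close> lies in the conductor and \<open>s y\<close> in \<open>K\<close>.\<close>
    have lL: "left_ideal ?L R"
    proof (rule left_idealI)
      show "\<zero> \<in> ?L"
        using y r by (auto intro!: exI[of _ \<zero>])
      show "a \<oplus> b \<in> ?L" if "a \<in> ?L" "b \<in> ?L" for a b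
        using that y r by (auto simp: l_distr[symmetric])
      show "s \<otimes> a \<in> ?L" if "s \<in> carrier R" "a \<in> ?L" for a s
        using that y r by clarsimp (metis m_assoc m_closed)
    qed (use y r in auto)
    have "y \<otimes> r \<in> ?L"
      using y r by (auto intro!: exI[of _ \<one>])
    then have "I <+>\<^bsub>R\<^esub> ?L \<noteq> I"
      using left_ideal_subset_set_add[OF lI lL] y by blast
    then have "I <+>\<^bsub>R\<^esub> ?L = carrier R"
      using max[OF left_ideal_set_add[OF lI lL]] left_ideal_subset_set_add[OF lI lL] by blast
    then have "r \<in> I <+>\<^bsub>R\<^esub> ?L"
      using r by simp
    then obtain i s where ri: "i \<in> I" "s \<in> carrier R" "r = i \<oplus> s \<otimes> (y \<otimes> r)"
      by (auto simp: set_add_iff)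
    have ic: "i \<in> carrier R"
      using ri(1) left_ideal_subset[OF lI] by auto
    have "(\<one> \<ominus> s \<otimes> y) \<otimes> r = r \<ominus> s \<otimes> (y \<otimes> r)"
      using r y ri(2) by (simp add: a_minus_def l_distr l_minus m_assoc)
    also have "\<dots> = (i \<oplus> s \<otimes> (y \<otimes> r)) \<ominus> s \<otimes> (y \<otimes> r)"
      using ri(3) by simp
    also have "\<dots> = i"
      using r y ri(2) ic by (simp add: a_minus_def a_assoc r_neg)
    finally have "\<one> \<ominus> s \<otimes> y \<in> ?C"
      using ri y by simp
    then have "(\<one> \<ominus> s \<otimes> y) \<oplus> s \<otimes> y \<in> K"
      using sub left_ideal_add[OF lK] left_ideal_mult[OF lK ri(2) y(1)] by blast
    then have "\<one> \<in> K"
      using ri(2) y by (simp add: a_minus_def a_assoc l_neg)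
    then show ?thesis
      by (rule left_ideal_one_imp_carrier[OF lK])
  qed
  moreover have "?C \<noteq> carrier R"
    using r one_closed by (metis (mono_tags, lifting) l_one mem_Collect_eq)
  ultimately show ?thesis
    using lC by (auto simp: maximal_left_ideal_def)
qed

text \<open>
  The radical is an intersection of left ideals. It absorbs a factor \<open>r\<close> on the right as well, because
  the conductor of \<open>r\<close> into a maximal left ideal is maximal or the whole ring.
\<close>

lemma jacobson_radical_ideal: "ideal (jacobson_radical R) R"
proof (rule idealI[OF ring_axioms])
  let ?J = "jacobson_radical R"
  show "subgroup ?J (add_monoid R)"
    using jacobson_radical_left_ideal by (simp add: left_ideal_def additive_subgroup_def)
  show "r \<otimes> x \<in> ?J" if "x \<in> ?J" "r \<in> carrier R" for x r
    using left_ideal_mult[OF jacobson_radical_left_ideal] that by blast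
  show "x \<otimes> r \<in> ?J" if x: "x \<in> ?J" and r: "r \<in> carrier R" for x r
  proof -
    have xc: "x \<in> carrier R"
      using x by (simp add: jacobson_radical_def)
    have "x \<otimes> r \<in> I" if I: "maximal_left_ideal I R" for I
    proof (cases "r \<in> I")
      case True
      then show ?thesis
        using I xc by (simp add: maximal_left_ideal_def left_ideal_mult)
    next
      case False
      then show ?thesis
        using maximal_left_ideal_conductor[OF I r] x by (auto simp: jacobson_radical_def)
    qed
    then show ?thesis
      using xc r by (auto simp: jacobson_radical_def)
  qed
qed

text \<open>
  Otherwise \<open>I + N\<close> is the whole ring. If \<open>\<one> = i + v\<close> with \<open>i \<in> I\<close> and \<open>v \<in> N\<close>, then
  \<open>v\<^sup>j = v\<^sup>j i + v\<^sup>j\<^sup>+\<^sup>1\<close> pulls membership in \<open>I\<close> down from a vanishing power of \<open>v\<close> to \<open>\<one>\<close>.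
\<close>

lemma nil_left_ideal_subset_maximal:
  assumes I: "maximal_left_ideal I R" and N: "left_ideal N R"
    and nil: "\<And>v. v \<in> N \<Longrightarrow> \<exists>k::nat. v [^] k = \<zero>"
  shows "N \<subseteq> I"
proof (rule ccontr)
  assume "\<not> N \<subseteq> I"
  have lI: "left_ideal I R" and ne: "I \<noteq> carrier R"
    using I by (auto simp: maximal_left_ideal_def)
  note c = subsetD[OF left_ideal_subset[OF lI]] subsetD[OF left_ideal_subset[OF N]]
  have "I <+>\<^bsub>R\<^esub> N = carrier R"
    using I left_ideal_subset_set_add[OF lI N] left_ideal_set_add[OF lI N] \<open>\<not> N \<subseteq> I\<close> by (auto simp: maximal_left_ideal_def)
  then have "\<one> \<in> I <+>\<^bsub>R\<^esub> N"
    by simp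
  then obtain i v where iv: "i \<in> I" "v \<in> N" "\<one> = i \<oplus> v"
    by (auto simp: set_add_iff)
  obtain k :: nat where k: "v [^] k = \<zero>"
    using nil iv by blast
  have "\<one> \<in> I" if "v [^] j \<in> I" for j :: nat
    using that
  proof (induction j)
    case (Suc j)
    have "v [^] j = v [^] j \<otimes> (i \<oplus> v)"
      using iv c by (simp flip: iv(3))
    also have "\<dots> = v [^] j \<otimes> i \<oplus> v [^] Suc j"
      using iv c by (simp add: r_distr)
    also have "\<dots> \<in> I"
      using Suc.prems iv c by (intro left_ideal_add[OF lI] left_ideal_mult[OF lI]) auto
    finally show ?case
      by (rule Suc.IH)
  qed simp
  then have "\<one> \<in> I"
    using k left_ideal_zero[OF lI] by metis
  then show False
    using ne left_ideal_one_imp_carrier[OF lI] by blast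
qed

end

section \<open>Lifting idempotents and nilpotent ideals\<close>

context ring
begin

lemma quotient_coset_eq_iff:
  assumes I: "ideal I R" and xy: "x \<in> carrier R" "y \<in> carrier R"
  shows "I +> x = I +> y \<longleftrightarrow> x \<ominus> y \<in> I"
  using quotient_eq_iff_same_a_r_cos[OF I xy] by auto

lemma idempotents_lift_iff:
  assumes I: "ideal I R"
  shows "idempotents_lift R I \<longleftrightarrow>
    (\<forall>x\<in>carrier R. x \<otimes> x \<ominus> x \<in> I \<longrightarrow> (\<exists>e\<in>carrier R. e \<otimes> e = e \<and> e \<ominus> x \<in> I))"
proof -
  interpret ideal I R
    by (rule I)
  have carr: "carrier (R Quot I) = (+>) I ` carrier R"
    by (auto simp: FactRing_def A_RCOSETS_def')
  have sq: "(I +> x) \<otimes>\<^bsub>R Quot I\<^esub> (I +> x) = I +> (x \<otimes> x)" if "x \<in> carrier R" for x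
    using that by (simp add: FactRing_def rcoset_mult_add)
  show ?thesis
    unfolding idempotents_lift_def carr
    by (simp add: sq quotient_coset_eq_iff[OF I])
qed

text \<open>
  An element of \<open>I\<^sup>k\<close> is a sum of products of \<open>k\<close> factors, up to a scalar. The spare list \<open>ys\<close> of
  \<open>m\<close> factors makes the induction on \<open>k\<close> work: the last factor of an element of \<open>I\<^sup>k\<^sup>+\<^sup>1\<close> moves into it.
\<close>

lemma ideal_prod_pow_nilpotent:
  assumes I: "ideal I R"
    and "\<And>xs. set xs \<subseteq> I \<Longrightarrow> length xs = k + m \<Longrightarrow> list_prod R xs = \<zero>"
    and "z \<in> ((\<lambda>K. ideal_prod R K I) ^^ k) (carrier R)"
    and "set ys \<subseteq> I" "length ys = m"
  shows "z \<otimes> list_prod R ys = \<zero>"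
  using assms(2-)
proof (induction k arbitrary: z ys m)
  case 0
  then show ?case
    by simp
next
  case (Suc k)
  interpret ideal I R
    by (rule I)
  let ?P = "((\<lambda>K. ideal_prod R K I) ^^ k) (carrier R)"
  have P: "ideal ?P R"
    by (induction k) (simp_all add: oneideal ideal_prod_is_ideal I)
  have ys: "list_prod R ys \<in> carrier R"
    using Suc.prems a_subset by (intro list_prod_closed) auto
  have "z \<in> ideal_prod R ?P I"
    using Suc.prems by simp
  then have "z \<in> carrier R \<and> z \<otimes> list_prod R ys = \<zero>"
  proof (induction z rule: ideal_prod.induct)
    case (prod a b)
    have "a \<otimes> list_prod R (b # ys) = \<zero>"
      by (rule Suc.IH[of "Suc m"]) (use Suc.prems prod in auto)
    then show ?case
      using prod ideal.Icarr[OF P] ys by (simp add: m_assoc)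
  next
    case (sum a b)
    then show ?case
      using ys by (simp add: l_distr)
  qed
  then show ?case
    by simp
qed

lemma list_prod_in_ideal_prod_pow:
  assumes I: "ideal I R" and "set xs \<subseteq> I"
  shows "list_prod R xs \<in> ((\<lambda>K. ideal_prod R K I) ^^ length xs) (carrier R)"
  using assms(2)
proof (induction xs rule: rev_induct)
  case (snoc x xs)
  interpret ideal I R
    by (rule I)
  have "list_prod R (xs @ [x]) = list_prod R xs \<otimes> x"
    using snoc.prems a_subset by (subst list_prod_append) auto
  then show ?case
    using snoc by (simp add: ideal_prod.prod)
qed simp

text \<open>
  The power \<open>I\<^sup>k\<close> is traded for lists of \<open>k\<close> factors from \<open>I\<close>, which ring homomorphisms
  and retractions act on directly.
\<close>

lemma nilpotent_ideal_iff:
  assumes I: "ideal I R"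
  shows "nilpotent_ideal R I \<longleftrightarrow>
    (\<exists>k\<ge>1. \<forall>xs. set xs \<subseteq> I \<longrightarrow> length xs = k \<longrightarrow> list_prod R xs = \<zero>)"
proof -
  have "((\<lambda>K. ideal_prod R K I) ^^ k) (carrier R) = {\<zero>} \<longleftrightarrow>
      (\<forall>xs. set xs \<subseteq> I \<longrightarrow> length xs = k \<longrightarrow> list_prod R xs = \<zero>)" (is "?P = _ \<longleftrightarrow> ?Q") for k
  proof
    assume "?P = {\<zero>}"
    then show ?Q
      using list_prod_in_ideal_prod_pow[OF I] by fastforce
  next
    assume ?Q
    have "ideal ?P R"
      by (induction k) (simp_all add: oneideal ideal_prod_is_ideal I)
    then have "\<zero> \<in> ?P" "?P \<subseteq> carrier R"
      by (simp_all add: additive_subgroup.zero_closed ideal.axioms(1) additive_subgroup.a_subset)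
    moreover have "z = \<zero>" if "z \<in> ?P" for z
      using ideal_prod_pow_nilpotent[OF I _ that, of 0 "[]"] \<open>?Q\<close> that calculation by auto
    ultimately show "?P = {\<zero>}"
      by blast
  qed
  then show ?thesis
    unfolding nilpotent_ideal_def by simp
qed

end

section \<open>Surjective ring homomorphisms\<close>

locale surjective_ring_hom = ring_hom_ring +
  assumes surj: "h ` carrier R = carrier S"
begin

lemma kernel_iff: "x \<in> a_kernel R S h \<longleftrightarrow> x \<in> carrier R \<and> h x = \<zero>\<^bsub>S\<^esub>"
  unfolding a_kernel_def' by simp

lemma hom_minus: "x \<in> carrier R \<Longrightarrow> y \<in> carrier R \<Longrightarrow> h (x \<ominus>\<^bsub>R\<^esub> y) = h x \<ominus>\<^bsub>S\<^esub> h y"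
  by (simp add: a_minus_def)

lemma surjE:
  assumes "y \<in> carrier S"
  obtains x where "x \<in> carrier R" "y = h x"
  using assms surj by auto

lemma left_ideal_image:
  assumes I: "left_ideal I R"
  shows "left_ideal (h ` I) S"
proof (rule S.left_idealI)
  note c = subsetD[OF R.left_ideal_subset[OF I]]
  show "h ` I \<subseteq> carrier S"
    using c by auto
  show "\<zero>\<^bsub>S\<^esub> \<in> h ` I"
    using R.left_ideal_zero[OF I] by (metis hom_zero imageI)
  show "x \<oplus>\<^bsub>S\<^esub> y \<in> h ` I" if "x \<in> h ` I" "y \<in> h ` I" for x y
    using that c R.left_ideal_add[OF I] by (auto simp: hom_add[symmetric] simp del: hom_add)
  show "r \<otimes>\<^bsub>S\<^esub> x \<in> h ` I" if r: "r \<in> carrier S" and x: "x \<in> h ` I" for r x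
  proof -
    obtain s where s: "s \<in> carrier R" "r = h s"
      using r by (rule surjE)
    obtain i where i: "i \<in> I" "x = h i"
      using x by blast
    have "r \<otimes>\<^bsub>S\<^esub> x = h (s \<otimes>\<^bsub>R\<^esub> i)"
      using s i c by simp
    then show ?thesis
      using s i R.left_ideal_mult[OF I] by simp
  qed
qed

lemma left_ideal_preimage:
  assumes L: "left_ideal L S"
  shows "left_ideal {x \<in> carrier R. h x \<in> L} R"
  by (rule R.left_idealI)
    (use L in \<open>auto simp: S.left_ideal_zero S.left_ideal_add S.left_ideal_mult\<close>)

lemma preimage_image:
  assumes I: "left_ideal I R" and ker: "a_kernel R S h \<subseteq> I"
  shows "{x \<in> carrier R. h x \<in> h ` I} = I"
proof
  note c = subsetD[OF R.left_ideal_subset[OF I]]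
  show "{x \<in> carrier R. h x \<in> h ` I} \<subseteq> I"
  proof clarify
    fix x y
    assume x: "x \<in> carrier R" and y: "y \<in> I" "h x = h y"
    have "x \<ominus>\<^bsub>R\<^esub> y \<in> a_kernel R S h"
      using x y c by (simp add: kernel_iff hom_minus a_minus_def S.r_neg)
    then have "x \<ominus>\<^bsub>R\<^esub> y \<in> I"
      using ker by blast
    then have "(x \<ominus>\<^bsub>R\<^esub> y) \<oplus>\<^bsub>R\<^esub> y \<in> I"
      using y R.left_ideal_add[OF I] by blast
    then show "x \<in> I"
      using x y c by (simp add: a_minus_def R.a_assoc R.l_neg)
  qed
qed (use R.left_ideal_subset[OF I] in auto)

lemma image_preimage:
  assumes "left_ideal L S"
  shows "h ` {x \<in> carrier R. h x \<in> L} = L"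
proof
  show "L \<subseteq> h ` {x \<in> carrier R. h x \<in> L}"
  proof
    fix y
    assume y: "y \<in> L"
    then have "y \<in> carrier S"
      using S.left_ideal_subset[OF assms] by blast
    then obtain x where "x \<in> carrier R" "y = h x"
      by (rule surjE)
    then show "y \<in> h ` {x \<in> carrier R. h x \<in> L}"
      using y by blast
  qed
qed blast

text \<open>
  Image and preimage give a bijection between the left ideals of \<open>S\<close> and those left ideals of \<open>R\<close> that
  contain the kernel. It preserves inclusion, and hence maximality.
\<close>

lemma maximal_left_ideal_preimage:
  assumes L: "maximal_left_ideal L S"
  shows "maximal_left_ideal {x \<in> carrier R. h x \<in> L} R" (is "maximal_left_ideal ?I R")
proof -
  have lL: "left_ideal L S" and ne: "L \<noteq> carrier S"
    and max: "\<And>K. left_ideal K S \<Longrightarrow> L \<subseteq> K \<Longrightarrow> K = L \<or> K = carrier S"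
    using L by (auto simp: maximal_left_ideal_def)
  have "K = ?I \<or> K = carrier R" if K: "left_ideal K R" "?I \<subseteq> K" for K
  proof -
    have "a_kernel R S h \<subseteq> K"
      using K S.left_ideal_zero[OF lL] by (auto simp: kernel_iff)
    then have eq: "{x \<in> carrier R. h x \<in> h ` K} = K"
      using K preimage_image by blast
    have "L \<subseteq> h ` K"
      using K image_preimage[OF lL] by blast
    then have "h ` K = L \<or> h ` K = carrier S"
      using max left_ideal_image K by blast
    then show ?thesis
      using eq by auto
  qed
  moreover have "?I \<noteq> carrier R"
    using image_preimage[OF lL] surj ne by auto
  ultimately show ?thesis
    using left_ideal_preimage[OF lL] by (simp add: maximal_left_ideal_def)
qed

lemma maximal_left_ideal_image:
  assumes I: "maximal_left_ideal I R" and ker: "a_kernel R S h \<subseteq> I"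
  shows "maximal_left_ideal (h ` I) S"
proof -
  have lI: "left_ideal I R" and ne: "I \<noteq> carrier R"
    and max: "\<And>K. left_ideal K R \<Longrightarrow> I \<subseteq> K \<Longrightarrow> K = I \<or> K = carrier R"
    using I by (auto simp: maximal_left_ideal_def)
  have "K = h ` I \<or> K = carrier S" if K: "left_ideal K S" "h ` I \<subseteq> K" for K
  proof -
    have "I \<subseteq> {x \<in> carrier R. h x \<in> K}"
      using K R.left_ideal_subset[OF lI] by auto
    then have "{x \<in> carrier R. h x \<in> K} = I \<or> {x \<in> carrier R. h x \<in> K} = carrier R"
      using max left_ideal_preimage K by blast
    then show ?thesis
      using image_preimage[OF K(1)] surj by metis
  qed
  moreover have "h ` I \<noteq> carrier S"
    using preimage_image[OF lI ker] ne by auto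
  ultimately show ?thesis
    using left_ideal_image[OF lI] by (simp add: maximal_left_ideal_def)
qed

text \<open>
  A nil kernel is contained in every maximal left ideal of \<open>R\<close>, so that all of them come from \<open>S\<close>.
\<close>

lemma jacobson_radical_preimage:
  assumes nil: "\<And>v. v \<in> a_kernel R S h \<Longrightarrow> \<exists>k::nat. v [^]\<^bsub>R\<^esub> k = \<zero>\<^bsub>R\<^esub>"
  shows "jacobson_radical R = {x \<in> carrier R. h x \<in> jacobson_radical S}"
proof
  show "jacobson_radical R \<subseteq> {x \<in> carrier R. h x \<in> jacobson_radical S}"
    using maximal_left_ideal_preimage by (auto simp: jacobson_radical_def)
  show "{x \<in> carrier R. h x \<in> jacobson_radical S} \<subseteq> jacobson_radical R"
  proof clarify
    fix x
    assume x: "x \<in> carrier R" "h x \<in> jacobson_radical S"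
    have "x \<in> I" if I: "maximal_left_ideal I R" for I
    proof -
      have ker: "a_kernel R S h \<subseteq> I"
        using R.nil_left_ideal_subset_maximal[OF I R.ideal_imp_left_ideal[OF kernel_is_ideal] nil] .
      have "h x \<in> h ` I"
        using x maximal_left_ideal_image[OF I ker] by (auto simp: jacobson_radical_def)
      then show ?thesis
        using preimage_image[OF _ ker] I x by (auto simp: maximal_left_ideal_def)
    qed
    then show "x \<in> jacobson_radical R"
      using x by (auto simp: jacobson_radical_def)
  qed
qed

text \<open>
  Semisimplicity of the image is a condition on left ideals of \<open>R\<close> that mentions \<open>S\<close> and \<open>h\<close> only
  through the kernel. Two rings onto which \<open>R\<close> maps with the same kernel are thus semisimple together.
\<close>

lemma semisimple_image_iff:
  "semisimple_ring S \<longleftrightarrow>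
    (\<forall>I. left_ideal I R \<longrightarrow> a_kernel R S h \<subseteq> I \<longrightarrow>
      (\<exists>K. left_ideal K R \<and> I \<inter> K = a_kernel R S h \<and> I <+>\<^bsub>R\<^esub> K = carrier R))"
  (is "_ \<longleftrightarrow> ?complemented")
proof
  assume ss: "semisimple_ring S"
  show ?complemented
  proof (intro allI impI)
    fix I
    assume I: "left_ideal I R" and ker: "a_kernel R S h \<subseteq> I"
    note c = subsetD[OF R.left_ideal_subset[OF I]]
    obtain L where L: "left_ideal L S" "h ` I \<inter> L = {\<zero>\<^bsub>S\<^esub>}" "h ` I <+>\<^bsub>S\<^esub> L = carrier S"
      using ss left_ideal_image[OF I] by (auto simp: semisimple_ring_def)
    let ?K = "{x \<in> carrier R. h x \<in> L}"
    have K: "left_ideal ?K R"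
      by (rule left_ideal_preimage[OF L(1)])
    have "I \<inter> ?K = a_kernel R S h"
      using L(2) ker c S.left_ideal_zero[OF L(1)] by (auto simp: kernel_iff)
    moreover have "x \<in> I <+>\<^bsub>R\<^esub> ?K" if x: "x \<in> carrier R" for x
    proof -
      have "h x \<in> h ` I <+>\<^bsub>S\<^esub> L"
        using x L(3) by simp
      then obtain i l where il: "i \<in> I" "l \<in> L" "h x = h i \<oplus>\<^bsub>S\<^esub> l"
        by (auto simp: S.set_add_iff)
      have lc: "l \<in> carrier S"
        using il S.left_ideal_subset[OF L(1)] by auto
      have "h (x \<ominus>\<^bsub>R\<^esub> i) = (h i \<oplus>\<^bsub>S\<^esub> l) \<ominus>\<^bsub>S\<^esub> h i"
        using x il c by (simp add: hom_minus)
      also have "\<dots> = l"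
        using il c lc by (simp add: a_minus_def S.a_ac S.r_neg)
      finally have "x \<ominus>\<^bsub>R\<^esub> i \<in> ?K"
        using il x c by simp
      moreover have "x = i \<oplus>\<^bsub>R\<^esub> (x \<ominus>\<^bsub>R\<^esub> i)"
        using x il c R.a_lcomm[of i x "\<ominus>\<^bsub>R\<^esub> i"] by (simp add: a_minus_def R.r_neg)
      ultimately show ?thesis
        using il by (auto simp: R.set_add_iff)
    qed
    then have "I <+>\<^bsub>R\<^esub> ?K = carrier R"
      using R.left_ideal_subset[OF R.left_ideal_set_add[OF I K]] by blast
    ultimately show "\<exists>K. left_ideal K R \<and> I \<inter> K = a_kernel R S h \<and> I <+>\<^bsub>R\<^esub> K = carrier R"
      using K by blast
  qed
next
  assume comp: ?complemented
  show "semisimple_ring S"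
    unfolding semisimple_ring_def
  proof (intro allI impI)
    fix L
    assume L: "left_ideal L S"
    let ?I = "{x \<in> carrier R. h x \<in> L}"
    have "a_kernel R S h \<subseteq> ?I"
      using S.left_ideal_zero[OF L] by (auto simp: kernel_iff)
    then obtain K where K: "left_ideal K R" "?I \<inter> K = a_kernel R S h" "?I <+>\<^bsub>R\<^esub> K = carrier R"
      using comp left_ideal_preimage[OF L] by blast
    note c = subsetD[OF R.left_ideal_subset[OF K(1)]]
    have "y = \<zero>\<^bsub>S\<^esub>" if y: "y \<in> L" "y \<in> h ` K" for y
    proof -
      obtain k where k: "k \<in> K" "y = h k"
        using y by blast
      then have "k \<in> a_kernel R S h"
        using K(2) y c by blast
      then show ?thesis
        using k by simp
    qed
    moreover have lK: "left_ideal (h ` K) S"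
      by (rule left_ideal_image[OF K(1)])
    ultimately have "L \<inter> h ` K = {\<zero>\<^bsub>S\<^esub>}"
      using S.left_ideal_zero[OF L] S.left_ideal_zero[OF lK] by blast
    moreover have "y \<in> L <+>\<^bsub>S\<^esub> h ` K" if y: "y \<in> carrier S" for y
    proof -
      obtain x where x: "x \<in> carrier R" "y = h x"
        using y by (rule surjE)
      then have "x \<in> ?I <+>\<^bsub>R\<^esub> K"
        using K(3) by simp
      then obtain i k where "i \<in> ?I" "k \<in> K" "x = i \<oplus>\<^bsub>R\<^esub> k"
        by (auto simp: R.set_add_iff)
      then show ?thesis
        using x c by (auto simp: S.set_add_iff)
    qed
    then have "L <+>\<^bsub>S\<^esub> h ` K = carrier S"
      using S.left_ideal_subset[OF S.left_ideal_set_add[OF L lK]] by blast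
    ultimately show "\<exists>K. left_ideal K S \<and> L \<inter> K = {\<zero>\<^bsub>S\<^esub>} \<and> L <+>\<^bsub>S\<^esub> K = carrier S"
      using lK by blast
  qed
qed

end

lemma (in ring) surjective_ring_hom_quotient:
  assumes I: "ideal I R"
  shows "surjective_ring_hom R (R Quot I) ((+>) I)"
    and "a_kernel R (R Quot I) ((+>) I) = I"
proof -
  interpret ideal I R
    by (rule I)
  show "surjective_ring_hom R (R Quot I) ((+>) I)"
    by (intro surjective_ring_hom.intro rcos_ring_hom_ring surjective_ring_hom_axioms.intro)
      (auto simp: FactRing_def A_RCOSETS_def')
  have "I +> x = I \<longleftrightarrow> x \<in> I" if "x \<in> carrier R" for x
    using rcos_const_imp_mem[OF that] a_rcos_const by blast
  then show "a_kernel R (R Quot I) ((+>) I) = I"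
    using a_subset by (auto simp: a_kernel_def' FactRing_def)
qed

section \<open>Split extensions by a nilpotent ideal\<close>

text \<open>
  \<open>R\<close> is the additive direct sum of a copy of \<open>S\<close> and an ideal whose \<open>n\<close>th power is zero.
\<close>

locale split_nilpotent_extension = ring_hom_ring +
  fixes \<iota> n
  assumes embedding: "ring_hom_ring S R \<iota>"
    and retraction: "y \<in> carrier S \<Longrightarrow> h (\<iota> y) = y"
    and n_pos: "n > 0"
    and kernel_nilpotent:
      "set xs \<subseteq> a_kernel R S h \<Longrightarrow> length xs = n \<Longrightarrow> list_prod R xs = \<zero>"

sublocale split_nilpotent_extension \<subseteq> E: ring_hom_ring S R \<iota>
  by (rule embedding)

sublocale split_nilpotent_extension \<subseteq> surjective_ring_hom R S h
proof
  show "h ` carrier R = carrier S"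
  proof
    show "carrier S \<subseteq> h ` carrier R"
      by (metis E.hom_closed imageI retraction subsetI)
  qed (simp add: image_subset_iff)
qed

context split_nilpotent_extension
begin

abbreviation "ker \<equiv> a_kernel R S h"

lemma kernel_subset: "ker \<subseteq> carrier R"
  by (auto simp: kernel_iff)

lemma kernel_pow_zero:
  assumes "v \<in> ker"
  shows "v [^]\<^bsub>R\<^esub> n = \<zero>\<^bsub>R\<^esub>"
proof -
  have "list_prod R (replicate n v) = \<zero>\<^bsub>R\<^esub>"
    by (rule kernel_nilpotent) (use assms in \<open>simp_all add: set_replicate_conv_if\<close>)
  moreover have "v \<in> carrier R"
    using assms kernel_subset by blast
  ultimately show ?thesis
    by (simp only: R.list_prod_replicate)
qed

lemma radical_iff: "x \<in> jacobson_radical R \<longleftrightarrow> x \<in> carrier R \<and> h x \<in> jacobson_radical S"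
  using jacobson_radical_preimage kernel_pow_zero by blast

lemma radical_lift: "y \<in> jacobson_radical S \<Longrightarrow> \<iota> y \<in> jacobson_radical R"
  by (simp add: radical_iff retraction subsetD[OF jacobson_radical_subset])

text \<open>
  \<open>R\<close> maps onto \<open>R / J(R)\<close> and, through \<open>S\<close>, onto \<open>S / J(S)\<close>, with the same kernel \<open>J(R)\<close>.
\<close>

lemma semilocal_iff: "semilocal S \<longleftrightarrow> semilocal R"
proof -
  let ?q = "(+>\<^bsub>S\<^esub>) (jacobson_radical S)" and ?Q = "S Quot jacobson_radical S"
  interpret q: surjective_ring_hom S ?Q ?q
    by (rule S.surjective_ring_hom_quotient(1)[OF S.jacobson_radical_ideal])
  interpret p: surjective_ring_hom R "R Quot jacobson_radical R" "(+>\<^bsub>R\<^esub>) (jacobson_radical R)"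
    by (rule R.surjective_ring_hom_quotient(1)[OF R.jacobson_radical_ideal])
  interpret qh: surjective_ring_hom R ?Q "?q \<circ> h"
  proof
    show "?q \<circ> h \<in> ring_hom R ?Q"
      by (rule ring_hom_trans[OF homh q.homh])
    show "(?q \<circ> h) ` carrier R = carrier ?Q"
      by (simp only: image_comp[symmetric] surj q.surj)
  qed
  have "a_kernel R ?Q (?q \<circ> h) = jacobson_radical R"
  proof (rule Set.set_eqI)
    fix x
    have "?q (h x) = \<zero>\<^bsub>?Q\<^esub> \<longleftrightarrow> h x \<in> jacobson_radical S" if "x \<in> carrier R"
      using q.kernel_iff[of "h x"] hom_closed[OF that]
      by (simp add: S.surjective_ring_hom_quotient(2)[OF S.jacobson_radical_ideal])
    then show "x \<in> a_kernel R ?Q (?q \<circ> h) \<longleftrightarrow> x \<in> jacobson_radical R"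
      by (auto simp: qh.kernel_iff radical_iff)
  qed
  then show ?thesis
    unfolding semilocal_def qh.semisimple_image_iff p.semisimple_image_iff
    by (simp add: R.surjective_ring_hom_quotient(2)[OF R.jacobson_radical_ideal])
qed

text \<open>
  The splitting carries idempotents upwards: if an idempotent \<open>f\<close> of \<open>S\<close> agrees with \<open>h x\<close> modulo the radical,
  then the idempotent \<open>\<iota> f\<close> of \<open>R\<close> agrees with \<open>x\<close> modulo the radical.
\<close>

lemma radical_idempotents_lift_iff:
  "idempotents_lift S (jacobson_radical S) \<longleftrightarrow> idempotents_lift R (jacobson_radical R)"
  (is "?liftS \<longleftrightarrow> ?liftR")
proof
  assume ?liftS
  then have lift: "\<exists>f\<in>carrier S. f \<otimes>\<^bsub>S\<^esub> f = f \<and> f \<ominus>\<^bsub>S\<^esub> y \<in> jacobson_radical S"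
    if "y \<in> carrier S" "y \<otimes>\<^bsub>S\<^esub> y \<ominus>\<^bsub>S\<^esub> y \<in> jacobson_radical S" for y
    using that S.idempotents_lift_iff[OF S.jacobson_radical_ideal] by blast
  have "\<exists>e\<in>carrier R. e \<otimes>\<^bsub>R\<^esub> e = e \<and> e \<ominus>\<^bsub>R\<^esub> x \<in> jacobson_radical R"
    if x: "x \<in> carrier R" "x \<otimes>\<^bsub>R\<^esub> x \<ominus>\<^bsub>R\<^esub> x \<in> jacobson_radical R" for x
  proof -
    have hx: "h x \<otimes>\<^bsub>S\<^esub> h x \<ominus>\<^bsub>S\<^esub> h x \<in> jacobson_radical S"
      using x by (simp add: radical_iff hom_minus)
    obtain f where f: "f \<in> carrier S" "f \<otimes>\<^bsub>S\<^esub> f = f" "f \<ominus>\<^bsub>S\<^esub> h x \<in> jacobson_radical S"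
      using lift[OF hom_closed[OF x(1)] hx] by (elim bexE conjE)
    then have "\<iota> f \<otimes>\<^bsub>R\<^esub> \<iota> f = \<iota> f"
      using E.hom_mult[of f f] by simp
    moreover have "\<iota> f \<ominus>\<^bsub>R\<^esub> x \<in> jacobson_radical R"
      using f x by (simp add: radical_iff hom_minus retraction)
    ultimately show ?thesis
      using f(1) by (intro bexI[of _ "\<iota> f"] conjI E.hom_closed)
  qed
  then show ?liftR
    using R.idempotents_lift_iff[OF R.jacobson_radical_ideal] by blast
next
  assume ?liftR
  then have lift: "\<exists>e\<in>carrier R. e \<otimes>\<^bsub>R\<^esub> e = e \<and> e \<ominus>\<^bsub>R\<^esub> x \<in> jacobson_radical R"
    if "x \<in> carrier R" "x \<otimes>\<^bsub>R\<^esub> x \<ominus>\<^bsub>R\<^esub> x \<in> jacobson_radical R" for x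
    using that R.idempotents_lift_iff[OF R.jacobson_radical_ideal] by blast
  have "\<exists>f\<in>carrier S. f \<otimes>\<^bsub>S\<^esub> f = f \<and> f \<ominus>\<^bsub>S\<^esub> y \<in> jacobson_radical S"
    if y: "y \<in> carrier S" "y \<otimes>\<^bsub>S\<^esub> y \<ominus>\<^bsub>S\<^esub> y \<in> jacobson_radical S" for y
  proof -
    have \<iota>y: "\<iota> y \<otimes>\<^bsub>R\<^esub> \<iota> y \<ominus>\<^bsub>R\<^esub> \<iota> y \<in> jacobson_radical R"
      using y by (simp add: radical_iff hom_minus retraction)
    obtain e where e: "e \<in> carrier R" "e \<otimes>\<^bsub>R\<^esub> e = e" "e \<ominus>\<^bsub>R\<^esub> \<iota> y \<in> jacobson_radical R"
      using lift[OF E.hom_closed[OF y(1)] \<iota>y] by (elim bexE conjE)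
    then have "h e \<otimes>\<^bsub>S\<^esub> h e = h e"
      using hom_mult[of e e] by simp
    moreover have "h e \<ominus>\<^bsub>S\<^esub> y \<in> jacobson_radical S"
      using e y by (simp add: radical_iff hom_minus retraction)
    ultimately show ?thesis
      using e(1) by (intro bexI[of _ "h e"] conjI hom_closed)
  qed
  then show ?liftS
    using S.idempotents_lift_iff[OF S.jacobson_radical_ideal] by blast
qed

lemma semiperfect_iff: "semiperfect S \<longleftrightarrow> semiperfect R"
  by (simp add: semiperfect_def semilocal_iff radical_idempotents_lift_iff)

text \<open>
  The family \<open>x p q\<close> is meant as the product of the segment from \<open>p\<close> to \<open>q\<close> of an infinite sequence,
  in the order of the sequence or in the reverse order. If a suitable segment with product in the
  kernel starts at every place, then \<open>n\<close> such segments in a row have product zero.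
\<close>

lemma segment_product_vanishes:
  fixes x :: "nat \<Rightarrow> nat \<Rightarrow> 'a"
  assumes step: "\<And>p. \<exists>q>p. x p q \<in> ker"
    and split: "(\<forall>p q r. p < q \<longrightarrow> q < r \<longrightarrow> x p r = x p q \<otimes>\<^bsub>R\<^esub> x q r) \<or>
      (\<forall>p q r. p < q \<longrightarrow> q < r \<longrightarrow> x p r = x q r \<otimes>\<^bsub>R\<^esub> x p q)"
  shows "\<exists>q>0. x 0 q = \<zero>\<^bsub>R\<^esub>"
proof -
  have "\<exists>q>p. \<exists>xs. set xs \<subseteq> ker \<and> length xs = Suc k \<and> x p q = list_prod R xs" for k p
  proof (induction k arbitrary: p)
    case 0
    obtain q where "q > p" "x p q \<in> ker"
      using step by blast
    then show ?case
      using kernel_subset by (intro exI[of _ q] conjI exI[of _ "[x p q]"]) auto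
  next
    case (Suc k)
    obtain q where q: "q > p" "x p q \<in> ker"
      using step by blast
    obtain r xs where r: "r > q" "set xs \<subseteq> ker" "length xs = Suc k" "x q r = list_prod R xs"
      using Suc.IH by blast
    from split show ?case
    proof
      assume "\<forall>p q r. p < q \<longrightarrow> q < r \<longrightarrow> x p r = x p q \<otimes>\<^bsub>R\<^esub> x q r"
      then have "x p r = list_prod R (x p q # xs)"
        using q r by simp
      then show ?thesis
        using q r by (intro exI[of _ r] conjI exI[of _ "x p q # xs"]) auto
    next
      assume "\<forall>p q r. p < q \<longrightarrow> q < r \<longrightarrow> x p r = x q r \<otimes>\<^bsub>R\<^esub> x p q"
      then have "x p r = x q r \<otimes>\<^bsub>R\<^esub> x p q"
        using q(1) r(1) by blast
      also have "\<dots> = list_prod R (xs @ [x p q])"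
        using q r kernel_subset by (subst R.list_prod_append) auto
      finally show ?thesis
        using q r by (intro exI[of _ r] conjI exI[of _ "xs @ [x p q]"]) auto
    qed
  qed
  from this[of 0 "n - 1"] show ?thesis
    using kernel_nilpotent n_pos by fastforce
qed

text \<open>
  The list function \<open>\<sigma>\<close> fixes the order of the factors, and covers left and right T-nilpotence at once.
  A product of radical elements of \<open>R\<close> falls into the kernel as soon as its image in \<open>S\<close> vanishes,
  and this happens on some segment from every starting place of the sequence.
\<close>

lemma T_nilpotent_iff:
  fixes \<sigma> :: "nat list \<Rightarrow> nat list"
  assumes \<sigma>: "\<sigma> = id \<or> \<sigma> = rev"
  shows "(\<forall>b. range b \<subseteq> jacobson_radical S \<longrightarrow>
        (\<exists>m\<ge>1. list_prod S (map b (\<sigma> [0..<m])) = \<zero>\<^bsub>S\<^esub>)) \<longleftrightarrow>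
      (\<forall>a. range a \<subseteq> jacobson_radical R \<longrightarrow>
        (\<exists>m\<ge>1. list_prod R (map a (\<sigma> [0..<m])) = \<zero>\<^bsub>R\<^esub>))"
    (is "?L \<longleftrightarrow> ?R")
proof
  assume nilS: ?L
  show ?R
  proof (intro allI impI)
    fix a :: "nat \<Rightarrow> 'a"
    assume a: "range a \<subseteq> jacobson_radical R"
    then have ac: "set (map a ks) \<subseteq> carrier R" for ks
      using jacobson_radical_subset by fastforce
    define x where "x p q = list_prod R (map a (\<sigma> [p..<q]))" for p q
    have "\<exists>q>0. x 0 q = \<zero>\<^bsub>R\<^esub>"
    proof (rule segment_product_vanishes)
      fix p
      have "range (\<lambda>k. h (a (k + p))) \<subseteq> jacobson_radical S"
        using range_subsetD[OF a] by (auto simp: radical_iff)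
      then obtain m where m: "m \<ge> 1" "list_prod S (map (\<lambda>k. h (a (k + p))) (\<sigma> [0..<m])) = \<zero>\<^bsub>S\<^esub>"
        using nilS by metis
      have "\<sigma> [p..<m + p] = map (\<lambda>k. k + p) (\<sigma> [0..<m])"
        using \<sigma> map_add_upt[of p m] by (auto simp flip: rev_map)
      then have "map (\<lambda>k. h (a (k + p))) (\<sigma> [0..<m]) = map h (map a (\<sigma> [p..<m + p]))"
        by (simp add: comp_def)
      then have "h (x p (m + p)) = \<zero>\<^bsub>S\<^esub>"
        using m(2) by (simp only: x_def hom_list_prod[OF ac])
      then show "\<exists>q>p. x p q \<in> ker"
        using m(1) R.list_prod_closed[OF ac] by (intro exI[of _ "m + p"]) (auto simp: kernel_iff x_def)
    next
      have upt: "[p..<r] = [p..<q] @ [q..<r]" if "p < q" "q < r" for p q r :: nat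
        using that upt_add_eq_append[of p q "r - q"] by simp
      from \<sigma> show "(\<forall>p q r. p < q \<longrightarrow> q < r \<longrightarrow> x p r = x p q \<otimes>\<^bsub>R\<^esub> x q r) \<or>
          (\<forall>p q r. p < q \<longrightarrow> q < r \<longrightarrow> x p r = x q r \<otimes>\<^bsub>R\<^esub> x p q)"
      proof
        assume "\<sigma> = id"
        then have "x p r = x p q \<otimes>\<^bsub>R\<^esub> x q r" if "p < q" "q < r" for p q r
          by (simp only: x_def id_apply upt[OF that] map_append R.list_prod_append[OF ac ac])
        then show ?thesis
          by blast
      next
        assume "\<sigma> = rev"
        then have "x p r = x q r \<otimes>\<^bsub>R\<^esub> x p q" if "p < q" "q < r" for p q r
          by (simp only: x_def rev_append upt[OF that] map_append R.list_prod_append[OF ac ac])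
        then show ?thesis
          by blast
      qed
    qed
    then show "\<exists>m\<ge>1. list_prod R (map a (\<sigma> [0..<m])) = \<zero>\<^bsub>R\<^esub>"
      by (auto simp: x_def Suc_le_eq)
  qed
next
  assume nilR: ?R
  show ?L
  proof (intro allI impI)
    fix b :: "nat \<Rightarrow> 'c"
    assume b: "range b \<subseteq> jacobson_radical S"
    then have "range (\<lambda>k. \<iota> (b k)) \<subseteq> jacobson_radical R"
      using radical_lift by (auto dest: range_subsetD)
    then obtain m where m: "m \<ge> 1" "list_prod R (map (\<lambda>k. \<iota> (b k)) (\<sigma> [0..<m])) = \<zero>\<^bsub>R\<^esub>"
      using nilR by metis
    have bc: "b k \<in> carrier S" for k
      by (rule subsetD[OF jacobson_radical_subset range_subsetD[OF b]])
    have "h (list_prod R (map (\<lambda>k. \<iota> (b k)) (\<sigma> [0..<m]))) = list_prod S (map b (\<sigma> [0..<m]))"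
      using bc by (subst hom_list_prod) (auto simp: comp_def retraction)
    then show "\<exists>m\<ge>1. list_prod S (map b (\<sigma> [0..<m])) = \<zero>\<^bsub>S\<^esub>"
      using m by (intro exI[of _ m]) simp
  qed
qed

lemma left_perfect_iff: "left_perfect S \<longleftrightarrow> left_perfect R"
  using T_nilpotent_iff[of id] by (simp add: left_perfect_def semilocal_iff left_T_nilpotent_def)

lemma right_perfect_iff: "right_perfect S \<longleftrightarrow> right_perfect R"
  using T_nilpotent_iff[of rev] by (simp add: right_perfect_def semilocal_iff right_T_nilpotent_def)

text \<open>
  Each of the \<open>m\<close> consecutive blocks of \<open>k\<close> factors has its product in the kernel.
\<close>

lemma radical_list_prod_blocks:
  assumes "\<And>ys. set ys \<subseteq> jacobson_radical S \<Longrightarrow> length ys = k \<Longrightarrow> list_prod S ys = \<zero>\<^bsub>S\<^esub>"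
    and "set xs \<subseteq> jacobson_radical R" "length xs = m * k"
  shows "\<exists>zs. set zs \<subseteq> ker \<and> length zs = m \<and> list_prod R xs = list_prod R zs"
  using assms(2-)
proof (induction m arbitrary: xs)
  case (Suc m)
  let ?b = "take k xs" and ?xs = "drop k xs"
  have sub: "set ?b \<subseteq> jacobson_radical R" "set ?xs \<subseteq> jacobson_radical R"
    using Suc.prems set_take_subset set_drop_subset by fast+
  then have c: "set ?b \<subseteq> carrier R" "set ?xs \<subseteq> carrier R"
    using sub[THEN subset_trans, OF jacobson_radical_subset] by simp_all
  obtain zs where zs: "set zs \<subseteq> ker" "length zs = m" "list_prod R ?xs = list_prod R zs"
    using Suc.IH[OF sub(2)] Suc.prems by auto
  have "h (list_prod R ?b) = list_prod S (map h ?b)"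
    by (rule hom_list_prod[OF c(1)])
  also have "\<dots> = \<zero>\<^bsub>S\<^esub>"
    by (rule assms(1)) (use sub(1) Suc.prems in \<open>auto simp: radical_iff\<close>)
  finally have "list_prod R ?b \<in> ker"
    using R.list_prod_closed[OF c(1)] by (simp add: kernel_iff)
  moreover have "list_prod R xs = list_prod R (list_prod R ?b # zs)"
    using R.list_prod_append[OF c] zs by simp
  ultimately show ?case
    using zs by (intro exI[of _ "list_prod R ?b # zs"]) auto
qed simp

lemma semiprimary_iff: "semiprimary S \<longleftrightarrow> semiprimary R"
proof -
  have "nilpotent_ideal S (jacobson_radical S) \<longleftrightarrow> nilpotent_ideal R (jacobson_radical R)"
    unfolding R.nilpotent_ideal_iff[OF R.jacobson_radical_ideal]
      S.nilpotent_ideal_iff[OF S.jacobson_radical_ideal]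
  proof
    assume "\<exists>k\<ge>1. \<forall>xs. set xs \<subseteq> jacobson_radical S \<longrightarrow> length xs = k \<longrightarrow> list_prod S xs = \<zero>\<^bsub>S\<^esub>"
    then obtain k where k: "k \<ge> 1"
      "\<And>xs. set xs \<subseteq> jacobson_radical S \<Longrightarrow> length xs = k \<Longrightarrow> list_prod S xs = \<zero>\<^bsub>S\<^esub>"
      by blast
    have "list_prod R xs = \<zero>\<^bsub>R\<^esub>"
      if "set xs \<subseteq> jacobson_radical R" "length xs = n * k" for xs
      using radical_list_prod_blocks[OF k(2) that] kernel_nilpotent by auto
    moreover have "n * k \<ge> 1"
      using n_pos k(1) by simp
    ultimately show "\<exists>k\<ge>1. \<forall>xs. set xs \<subseteq> jacobson_radical R \<longrightarrow> length xs = k \<longrightarrow>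
        list_prod R xs = \<zero>\<^bsub>R\<^esub>"
      by blast
  next
    assume "\<exists>k\<ge>1. \<forall>xs. set xs \<subseteq> jacobson_radical R \<longrightarrow> length xs = k \<longrightarrow> list_prod R xs = \<zero>\<^bsub>R\<^esub>"
    then obtain k where k: "k \<ge> 1"
      "\<And>xs. set xs \<subseteq> jacobson_radical R \<Longrightarrow> length xs = k \<Longrightarrow> list_prod R xs = \<zero>\<^bsub>R\<^esub>"
      by blast
    have "list_prod S ys = \<zero>\<^bsub>S\<^esub>" if ys: "set ys \<subseteq> jacobson_radical S" "length ys = k" for ys
    proof -
      have c: "set ys \<subseteq> carrier S"
        by (rule subset_trans[OF ys(1) jacobson_radical_subset])
      have "h (list_prod R (map \<iota> ys)) = list_prod S (map h (map \<iota> ys))"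
        using c by (intro hom_list_prod) auto
      also have "map h (map \<iota> ys) = ys"
        using c by (auto simp: retraction intro!: map_idI)
      finally have "h (list_prod R (map \<iota> ys)) = list_prod S ys" .
      moreover have "list_prod R (map \<iota> ys) = \<zero>\<^bsub>R\<^esub>"
        by (rule k(2)) (use ys radical_lift in auto)
      ultimately show ?thesis
        by simp
    qed
    then show "\<exists>k\<ge>1. \<forall>xs. set xs \<subseteq> jacobson_radical S \<longrightarrow> length xs = k \<longrightarrow>
        list_prod S xs = \<zero>\<^bsub>S\<^esub>"
      using k(1) by blast
  qed
  then show ?thesis
    by (simp add: semiprimary_def semilocal_iff)
qed

text \<open>
  If \<open>k\<close> bounds the index in \<open>S\<close>, then \<open>v\<^sup>k\<close> lies in the kernel for every nilpotent \<open>v\<close>, and \<open>k n\<close> bounds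
  the index in \<open>R\<close>.
\<close>

lemma bounded_index_iff: "bounded_index S \<longleftrightarrow> bounded_index R"
proof
  assume "bounded_index S"
  then obtain k :: nat where k: "k > 0"
    "\<And>v m. v \<in> carrier S \<Longrightarrow> v [^]\<^bsub>S\<^esub> (m::nat) = \<zero>\<^bsub>S\<^esub> \<Longrightarrow> v [^]\<^bsub>S\<^esub> k = \<zero>\<^bsub>S\<^esub>"
    unfolding bounded_index_def by blast
  have "v [^]\<^bsub>R\<^esub> (k * n) = \<zero>\<^bsub>R\<^esub>" if v: "v \<in> carrier R" "v [^]\<^bsub>R\<^esub> (m::nat) = \<zero>\<^bsub>R\<^esub>" for v m
  proof -
    have "h v [^]\<^bsub>S\<^esub> m = \<zero>\<^bsub>S\<^esub>"
      using v by (simp flip: hom_nat_pow)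
    then have "h v [^]\<^bsub>S\<^esub> k = \<zero>\<^bsub>S\<^esub>"
      by (rule k(2)[OF hom_closed[OF v(1)]])
    then have "v [^]\<^bsub>R\<^esub> k \<in> ker"
      using v by (simp add: kernel_iff hom_nat_pow)
    then show ?thesis
      using kernel_pow_zero v by (simp flip: R.nat_pow_pow)
  qed
  then show "bounded_index R"
    unfolding bounded_index_def using k(1) n_pos by (intro exI[of _ "k * n"]) auto
next
  assume "bounded_index R"
  then obtain k :: nat where k: "k > 0"
    "\<And>v m. v \<in> carrier R \<Longrightarrow> v [^]\<^bsub>R\<^esub> (m::nat) = \<zero>\<^bsub>R\<^esub> \<Longrightarrow> v [^]\<^bsub>R\<^esub> k = \<zero>\<^bsub>R\<^esub>"
    unfolding bounded_index_def by blast
  have "v [^]\<^bsub>S\<^esub> k = \<zero>\<^bsub>S\<^esub>" if v: "v \<in> carrier S" "v [^]\<^bsub>S\<^esub> (m::nat) = \<zero>\<^bsub>S\<^esub>" for v m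
  proof -
    have "\<iota> v [^]\<^bsub>R\<^esub> m = \<zero>\<^bsub>R\<^esub>"
      using v by (simp flip: E.hom_nat_pow)
    then have "\<iota> v [^]\<^bsub>R\<^esub> k = \<zero>\<^bsub>R\<^esub>"
      by (rule k(2)[OF E.hom_closed[OF v(1)]])
    then have "h (\<iota> (v [^]\<^bsub>S\<^esub> k)) = \<zero>\<^bsub>S\<^esub>"
      using v by (simp add: E.hom_nat_pow)
    then show ?thesis
      using v by (simp add: retraction)
  qed
  then show "bounded_index S"
    unfolding bounded_index_def using k(1) by blast
qed

end

section \<open>Finite sums in abelian groups\<close>

lemma (in abelian_group_hom) hom_finsum:
  "f \<in> A \<rightarrow> carrier G \<Longrightarrow> h (\<Oplus>\<^bsub>G\<^esub>a\<in>A. f a) = (\<Oplus>\<^bsub>H\<^esub>a\<in>A. h (f a))"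
proof (induction A rule: infinite_finite_induct)
  case (insert a A)
  then have "f \<in> A \<rightarrow> carrier G" "f a \<in> carrier G" "(\<lambda>a. h (f a)) \<in> A \<rightarrow> carrier H"
    by (auto simp: Pi_iff)
  then show ?case
    using insert by (simp add: G.finsum_insert H.finsum_insert)
qed (simp_all add: G.finsum_infinite H.finsum_infinite)

lemma (in abelian_monoid) finsum_swap:
  assumes "finite A" "finite B"
    and "\<And>a b. a \<in> A \<Longrightarrow> b \<in> B \<Longrightarrow> f a b \<in> carrier G"
  shows "(\<Oplus>a\<in>A. \<Oplus>b\<in>B. f a b) = (\<Oplus>b\<in>B. \<Oplus>a\<in>A. f a b)"
  using assms(1,3)
proof (induction A)
  case empty
  then show ?case
    by (simp add: finsum_zero)
next
  case (insert a A)
  have "(\<Oplus>a\<in>insert a A. \<Oplus>b\<in>B. f a b) = (\<Oplus>b\<in>B. f a b) \<oplus> (\<Oplus>a\<in>A. \<Oplus>b\<in>B. f a b)"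
    using insert by (intro finsum_insert) (auto intro!: finsum_closed)
  also have "\<dots> = (\<Oplus>b\<in>B. f a b) \<oplus> (\<Oplus>b\<in>B. \<Oplus>a\<in>A. f a b)"
    using insert by simp
  also have "\<dots> = (\<Oplus>b\<in>B. f a b \<oplus> (\<Oplus>a\<in>A. f a b))"
    using insert by (intro finsum_addf[symmetric]) (auto intro!: finsum_closed)
  also have "\<dots> = (\<Oplus>b\<in>B. \<Oplus>a\<in>insert a A. f a b)"
    using insert by (intro finsum_cong' finsum_insert[symmetric]) (auto intro!: finsum_closed)
  finally show ?case .
qed

section \<open>Pure tensors\<close>

lemma regular_bimodule_is_bimodule:
  assumes "ring R"
  shows "bimodule R R (regular_bimodule R)"
proof -
  interpret ring R
    by (rule assms)
  have "abelian_group (regular_bimodule R)"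
    by (rule abelian_groupI)
      (auto simp: regular_bimodule_def a_assoc intro: a_comm l_neg a_inv_closed)
  then show ?thesis
    by (intro bimodule.intro assms bimodule_axioms.intro)
      (auto simp: regular_bimodule_def l_distr r_distr m_assoc)
qed

locale bimodule_pair = MM: bimodule R S M + NN: bimodule S T N
  for R :: "('r, 'x) ring_scheme" and S :: "('s, 'y) ring_scheme" and T :: "('t, 'z) ring_scheme"
    and M :: "('r, 's, 'm, 'v) bimodule_scheme" and N :: "('s, 't, 'n, 'w) bimodule_scheme"
begin

lemma relators_subset: "tensor_relators S M N \<subseteq> carrier (tensor_free M N)"
  unfolding tensor_relators_def
  by (auto simp: MM.rsmult_closed NN.smult_closed dest!: subsetD[OF keys_diff] subsetD[OF keys_add])

lemma kernel_subgroup: "subgroup (tensor_kernel S M N) (tensor_free M N)"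
  unfolding tensor_kernel_def
  by (rule group.generate_is_subgroup[OF group_free_Abelian_group relators_subset])

lemma kernel_normal: "normal (tensor_kernel S M N) (tensor_free M N)"
  by (rule comm_group.subgroup_imp_normal[OF abelian_free_Abelian_group kernel_subgroup])

lemma pure_tensor_closed:
  "x \<in> carrier M \<Longrightarrow> y \<in> carrier N \<Longrightarrow> pure_tensor S M N x y \<in> carrier (tensor_product S M N)"
  by (auto simp: pure_tensor_def tensor_product_def FactGroup_def RCOSETS_def Let_def
      simp del: carrier_free_Abelian_group_iff)

lemma coset_eq_of_relator:
  assumes "u - v \<in> tensor_relators S M N"
    and "u \<in> carrier (tensor_free M N)" "v \<in> carrier (tensor_free M N)"
  shows "tensor_kernel S M N #>\<^bsub>tensor_free M N\<^esub> u = tensor_kernel S M N #>\<^bsub>tensor_free M N\<^esub> v"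
proof -
  interpret F: group "tensor_free M N"
    by (rule group_free_Abelian_group)
  have "u - v \<in> tensor_kernel S M N"
    unfolding tensor_kernel_def by (rule generate.incl[OF assms(1)])
  then have "u \<in> tensor_kernel S M N #>\<^bsub>tensor_free M N\<^esub> v"
    by (auto simp: r_coset_def intro!: bexI[of _ "u - v"])
  then show ?thesis
    using F.repr_independence[OF _ assms(3) kernel_subgroup] by simp
qed

lemma coset_add:
  assumes "u \<in> carrier (tensor_free M N)" "v \<in> carrier (tensor_free M N)"
  shows "tensor_kernel S M N #>\<^bsub>tensor_free M N\<^esub> (u + v) =
    (tensor_kernel S M N #>\<^bsub>tensor_free M N\<^esub> u) \<oplus>\<^bsub>tensor_product S M N\<^esub>
    (tensor_kernel S M N #>\<^bsub>tensor_free M N\<^esub> v)"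
  using normal.rcos_sum[OF kernel_normal assms]
  by (simp add: tensor_product_def Let_def FactGroup_def)

text \<open>
  The relators give biadditivity of the pure tensors, which makes \<open>\<theta>\<close> biadditive on pairs of entries.
\<close>

lemma pure_tensor_add_left:
  assumes "x \<in> carrier M" "x' \<in> carrier M" "y \<in> carrier N"
  shows "pure_tensor S M N (x \<oplus>\<^bsub>M\<^esub> x') y =
    pure_tensor S M N x y \<oplus>\<^bsub>tensor_product S M N\<^esub> pure_tensor S M N x' y"
proof -
  have "frag_of (x \<oplus>\<^bsub>M\<^esub> x', y) - (frag_of (x, y) + frag_of (x', y)) \<in> tensor_relators S M N"
    unfolding tensor_relators_def using assms by blast
  then show ?thesis
    unfolding pure_tensor_def using assms
    by (subst coset_add[symmetric], simp, simp, intro coset_eq_of_relator)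
      (auto dest!: subsetD[OF keys_add])
qed

lemma pure_tensor_add_right:
  assumes "x \<in> carrier M" "y \<in> carrier N" "y' \<in> carrier N"
  shows "pure_tensor S M N x (y \<oplus>\<^bsub>N\<^esub> y') =
    pure_tensor S M N x y \<oplus>\<^bsub>tensor_product S M N\<^esub> pure_tensor S M N x y'"
proof -
  have "frag_of (x, y \<oplus>\<^bsub>N\<^esub> y') - (frag_of (x, y) + frag_of (x, y')) \<in> tensor_relators S M N"
    unfolding tensor_relators_def using assms by blast
  then show ?thesis
    unfolding pure_tensor_def using assms
    by (subst coset_add[symmetric], simp, simp, intro coset_eq_of_relator)
      (auto dest!: subsetD[OF keys_add])
qed

end

section \<open>The generalized matrix ring\<close>

context generalized_matrix_ring
begin

abbreviation "emult \<equiv> entry_mult R M \<theta>"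

lemma bimodule_entry:
  assumes "i \<in> {1..n}" "j \<in> {1..n}"
  shows "bimodule (R i) (R j) (M i j)"
  using assms entry_bimodule diagonal_entry regular_bimodule_is_bimodule[OF diagonal_ring]
  by (cases "i = j") simp_all

lemma abelian_group_entry: "i \<in> {1..n} \<Longrightarrow> j \<in> {1..n} \<Longrightarrow> abelian_group (M i j)"
  using bimodule_entry bimodule.axioms(3) by blast

lemma theta_additive:
  assumes "i \<in> {1..n}" "j \<in> {1..n}" "k \<in> {1..n}"
  shows "\<theta> i j k \<in> hom (add_monoid (tensor_product (R j) (M i j) (M j k))) (add_monoid (M i k))"
  using theta_hom[OF assms] by (simp add: bimodule_hom_def)

lemma bimodule_pair_entry:
  "i \<in> {1..n} \<Longrightarrow> j \<in> {1..n} \<Longrightarrow> k \<in> {1..n} \<Longrightarrow> bimodule_pair (R i) (R j) (R k) (M i j) (M j k)"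
  by (intro bimodule_pair.intro bimodule_entry)

lemma emult_closed:
  assumes "i \<in> {1..n}" "j \<in> {1..n}" "k \<in> {1..n}" "x \<in> carrier (M i j)" "y \<in> carrier (M j k)"
  shows "emult i j k x y \<in> carrier (M i k)"
  using hom_in_carrier[OF theta_additive] assms
    bimodule_pair.pure_tensor_closed[OF bimodule_pair_entry]
  by (simp add: entry_mult_def)

lemma emult_left_hom:
  assumes ijk: "i \<in> {1..n}" "j \<in> {1..n}" "k \<in> {1..n}" and y: "y \<in> carrier (M j k)"
  shows "abelian_group_hom (M i j) (M i k) (\<lambda>x. emult i j k x y)"
proof (rule abelian_group_homI)
  interpret bimodule_pair "R i" "R j" "R k" "M i j" "M j k"
    by (rule bimodule_pair_entry[OF ijk])
  show "group_hom (add_monoid (M i j)) (add_monoid (M i k)) (\<lambda>x. emult i j k x y)"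
    using ijk y hom_mult[OF theta_additive[OF ijk]]
    by (intro group_hom.intro group_hom_axioms.intro homI abelian_group.a_group abelian_group_entry)
      (auto simp: emult_closed[unfolded entry_mult_def] entry_mult_def pure_tensor_add_left pure_tensor_closed)
qed (intro abelian_group_entry ijk)+

lemma emult_right_hom:
  assumes ijk: "i \<in> {1..n}" "j \<in> {1..n}" "k \<in> {1..n}" and x: "x \<in> carrier (M i j)"
  shows "abelian_group_hom (M j k) (M i k) (emult i j k x)"
proof (rule abelian_group_homI)
  interpret bimodule_pair "R i" "R j" "R k" "M i j" "M j k"
    by (rule bimodule_pair_entry[OF ijk])
  show "group_hom (add_monoid (M j k)) (add_monoid (M i k)) (emult i j k x)"
    using ijk x hom_mult[OF theta_additive[OF ijk]]
    by (intro group_hom.intro group_hom_axioms.intro homI abelian_group.a_group abelian_group_entry)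
      (auto simp: emult_closed[unfolded entry_mult_def] entry_mult_def pure_tensor_add_right pure_tensor_closed)
qed (intro abelian_group_entry ijk)+

lemma unit_in_entry: "i \<in> {1..n} \<Longrightarrow> \<one>\<^bsub>R i\<^esub> \<in> carrier (M i i)"
  using diagonal_entry diagonal_ring
  by (simp add: regular_bimodule_def ring.ring_simprules(6))

lemma emult_one_left:
  assumes "i \<in> {1..n}" "k \<in> {1..n}" "x \<in> carrier (M i k)"
  shows "emult i i k \<one>\<^bsub>R i\<^esub> x = x"
  using assms theta_jjk bimodule.smult_one[OF bimodule_entry]
    ring.ring_simprules(6)[OF diagonal_ring] by simp

lemma emult_one_right:
  assumes "i \<in> {1..n}" "k \<in> {1..n}" "x \<in> carrier (M i k)"
  shows "emult i k k x \<one>\<^bsub>R k\<^esub> = x"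
  using assms theta_ijj bimodule.rsmult_one[OF bimodule_entry]
    ring.ring_simprules(6)[OF diagonal_ring] by simp

abbreviation "GM \<equiv> gmat_ring n R M \<theta>"

lemma gmat_entry_closed:
  "A \<in> carrier GM \<Longrightarrow> i \<in> {1..n} \<Longrightarrow> j \<in> {1..n} \<Longrightarrow> A i j \<in> carrier (M i j)"
  unfolding gmat_ring_def by (simp add: PiE_iff)

lemma gmat_eqI:
  assumes "A \<in> carrier GM" "B \<in> carrier GM"
    and "\<And>i j. i \<in> {1..n} \<Longrightarrow> j \<in> {1..n} \<Longrightarrow> A i j = B i j"
  shows "A = B"
proof (rule PiE_ext)
  show "A \<in> (\<Pi>\<^sub>E i\<in>{1..n}. \<Pi>\<^sub>E j\<in>{1..n}. carrier (M i j))"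
    and "B \<in> (\<Pi>\<^sub>E i\<in>{1..n}. \<Pi>\<^sub>E j\<in>{1..n}. carrier (M i j))"
    using assms(1,2) by (simp_all add: gmat_ring_def)
  then show "A i = B i" if "i \<in> {1..n}" for i
    using assms(3) that by (intro PiE_ext[of "A i" "{1..n}" "\<lambda>j. carrier (M i j)"]) (auto dest: PiE_mem)
qed

lemma gmat_mult_entry:
  "i \<in> {1..n} \<Longrightarrow> k \<in> {1..n} \<Longrightarrow>
    (A \<otimes>\<^bsub>GM\<^esub> B) i k = (\<Oplus>\<^bsub>M i k\<^esub>j\<in>{1..n}. emult i j k (A i j) (B j k))"
  by (simp add: gmat_ring_def)

lemma gmat_add_entry:
  "i \<in> {1..n} \<Longrightarrow> j \<in> {1..n} \<Longrightarrow> (A \<oplus>\<^bsub>GM\<^esub> B) i j = A i j \<oplus>\<^bsub>M i j\<^esub> B i j"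
  by (simp add: gmat_ring_def)

lemma gmat_one_entry:
  "i \<in> {1..n} \<Longrightarrow> j \<in> {1..n} \<Longrightarrow> \<one>\<^bsub>GM\<^esub> i j = (if i = j then \<one>\<^bsub>R i\<^esub> else \<zero>\<^bsub>M i j\<^esub>)"
  by (simp add: gmat_ring_def)

lemma gmat_zero_entry: "i \<in> {1..n} \<Longrightarrow> j \<in> {1..n} \<Longrightarrow> \<zero>\<^bsub>GM\<^esub> i j = \<zero>\<^bsub>M i j\<^esub>"
  by (simp add: gmat_ring_def)

lemmas gmat_entries = gmat_mult_entry gmat_add_entry gmat_one_entry gmat_zero_entry

lemma gmat_add_closed: "A \<in> carrier GM \<Longrightarrow> B \<in> carrier GM \<Longrightarrow> A \<oplus>\<^bsub>GM\<^esub> B \<in> carrier GM"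
  using abelian_group_entry
  by (auto simp: gmat_ring_def PiE_iff intro!: abelian_monoid.a_closed abelian_group.axioms(1))

lemma gmat_zero_closed: "\<zero>\<^bsub>GM\<^esub> \<in> carrier GM"
  using abelian_group_entry
  by (auto simp: gmat_ring_def PiE_iff intro!: abelian_monoid.zero_closed abelian_group.axioms(1))

lemma gmat_one_closed: "\<one>\<^bsub>GM\<^esub> \<in> carrier GM"
  using abelian_group_entry unit_in_entry
  by (auto simp: gmat_ring_def PiE_iff intro!: abelian_monoid.zero_closed abelian_group.axioms(1))

lemma gmat_mult_terms:
  assumes "A \<in> carrier GM" "B \<in> carrier GM" "i \<in> {1..n}" "k \<in> {1..n}"
  shows "(\<lambda>j. emult i j k (A i j) (B j k)) \<in> {1..n} \<rightarrow> carrier (M i k)"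
  by (intro funcsetI emult_closed gmat_entry_closed[OF assms(1)] gmat_entry_closed[OF assms(2)] assms(3,4))

lemma gmat_mult_closed:
  assumes "A \<in> carrier GM" "B \<in> carrier GM"
  shows "A \<otimes>\<^bsub>GM\<^esub> B \<in> carrier GM"
  using abelian_monoid.finsum_closed[OF abelian_group.axioms(1)[OF abelian_group_entry]
      gmat_mult_terms[OF assms]]
  by (auto simp: gmat_ring_def PiE_iff)

lemma abelian_group_gmat: "abelian_group GM"
proof (rule abelian_groupI)
  note mon = abelian_group.axioms(1)[OF abelian_group_entry]
  fix A
  assume A: "A \<in> carrier GM"
  let ?B = "\<lambda>i\<in>{1..n}. \<lambda>j\<in>{1..n}. \<ominus>\<^bsub>M i j\<^esub> (A i j)"
  have B: "?B \<in> carrier GM"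
    using gmat_entry_closed[OF A] abelian_group.a_inv_closed[OF abelian_group_entry]
    by (auto simp: gmat_ring_def PiE_iff)
  show "\<exists>B\<in>carrier GM. B \<oplus>\<^bsub>GM\<^esub> A = \<zero>\<^bsub>GM\<^esub>"
  proof
    show "?B \<oplus>\<^bsub>GM\<^esub> A = \<zero>\<^bsub>GM\<^esub>"
      using abelian_group.l_neg[OF abelian_group_entry] gmat_entry_closed[OF A]
      by (intro gmat_eqI gmat_add_closed gmat_zero_closed A B) (simp add: gmat_entries)
  qed (rule B)
  show "\<zero>\<^bsub>GM\<^esub> \<oplus>\<^bsub>GM\<^esub> A = A"
    using abelian_monoid.l_zero[OF mon] gmat_entry_closed[OF A]
    by (intro gmat_eqI gmat_add_closed gmat_zero_closed A) (simp add: gmat_entries)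
  fix B
  assume B: "B \<in> carrier GM"
  show "A \<oplus>\<^bsub>GM\<^esub> B = B \<oplus>\<^bsub>GM\<^esub> A"
    using abelian_monoid.a_comm[OF mon] gmat_entry_closed[OF A] gmat_entry_closed[OF B]
    by (intro gmat_eqI gmat_add_closed A B) (simp add: gmat_entries)
  fix C
  assume C: "C \<in> carrier GM"
  show "A \<oplus>\<^bsub>GM\<^esub> B \<oplus>\<^bsub>GM\<^esub> C = A \<oplus>\<^bsub>GM\<^esub> (B \<oplus>\<^bsub>GM\<^esub> C)"
    using abelian_monoid.a_assoc[OF mon] gmat_entry_closed[OF A] gmat_entry_closed[OF B]
      gmat_entry_closed[OF C]
    by (intro gmat_eqI gmat_add_closed A B C) (simp add: gmat_entries)
qed (simp_all add: gmat_add_closed gmat_zero_closed)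

text \<open>
  By biadditivity both sides are double sums over \<open>j\<close> and \<open>k\<close> of the terms \<open>A\<^sub>i\<^sub>j (B\<^sub>j\<^sub>k C\<^sub>k\<^sub>l)\<close>.
\<close>

lemma gmat_mult_assoc:
  assumes A: "A \<in> carrier GM" and B: "B \<in> carrier GM" and C: "C \<in> carrier GM"
  shows "(A \<otimes>\<^bsub>GM\<^esub> B) \<otimes>\<^bsub>GM\<^esub> C = A \<otimes>\<^bsub>GM\<^esub> (B \<otimes>\<^bsub>GM\<^esub> C)"
proof (intro gmat_eqI gmat_mult_closed A B C)
  fix i l
  assume il: "i \<in> {1..n}" "l \<in> {1..n}"
  note c = gmat_entry_closed[OF A] gmat_entry_closed[OF B] gmat_entry_closed[OF C]
  interpret il: abelian_group "M i l"
    by (rule abelian_group_entry[OF il])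
  let ?t = "\<lambda>j k. emult i j l (A i j) (emult j k l (B j k) (C k l))"
  have t: "?t j k \<in> carrier (M i l)" if "j \<in> {1..n}" "k \<in> {1..n}" for j k
    using that il by (intro emult_closed c)
  have "((A \<otimes>\<^bsub>GM\<^esub> B) \<otimes>\<^bsub>GM\<^esub> C) i l =
      (\<Oplus>\<^bsub>M i l\<^esub>k\<in>{1..n}. emult i k l (\<Oplus>\<^bsub>M i k\<^esub>j\<in>{1..n}. emult i j k (A i j) (B j k)) (C k l))"
    unfolding gmat_mult_entry[OF il]
    by (rule il.finsum_cong')
      (use il in \<open>auto simp: gmat_mult_entry intro!: emult_closed c
        abelian_monoid.finsum_closed[OF abelian_group.axioms(1)[OF abelian_group_entry]]\<close>)
  also have "\<dots> = (\<Oplus>\<^bsub>M i l\<^esub>k\<in>{1..n}. \<Oplus>\<^bsub>M i l\<^esub>j\<in>{1..n}. ?t j k)"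
  proof (rule il.finsum_cong'[OF refl])
    fix k
    assume k: "k \<in> {1..n}"
    have "emult i k l (\<Oplus>\<^bsub>M i k\<^esub>j\<in>{1..n}. emult i j k (A i j) (B j k)) (C k l) =
        (\<Oplus>\<^bsub>M i l\<^esub>j\<in>{1..n}. emult i k l (emult i j k (A i j) (B j k)) (C k l))"
      using il k by (intro abelian_group_hom.hom_finsum[OF emult_left_hom] gmat_mult_terms A B c)
    also have "\<dots> = (\<Oplus>\<^bsub>M i l\<^esub>j\<in>{1..n}. ?t j k)"
      using il k t by (intro il.finsum_cong') (auto intro!: entry_mult_assoc c)
    finally show "emult i k l (\<Oplus>\<^bsub>M i k\<^esub>j\<in>{1..n}. emult i j k (A i j) (B j k)) (C k l) =
        (\<Oplus>\<^bsub>M i l\<^esub>j\<in>{1..n}. ?t j k)" .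
  qed (auto intro!: il.finsum_closed t)
  also have "\<dots> = (\<Oplus>\<^bsub>M i l\<^esub>j\<in>{1..n}. \<Oplus>\<^bsub>M i l\<^esub>k\<in>{1..n}. ?t j k)"
    by (rule il.finsum_swap) (auto intro: t)
  also have "\<dots> = (\<Oplus>\<^bsub>M i l\<^esub>j\<in>{1..n}. emult i j l (A i j) ((B \<otimes>\<^bsub>GM\<^esub> C) j l))"
  proof (rule il.finsum_cong'[OF refl])
    show "(\<lambda>j. emult i j l (A i j) ((B \<otimes>\<^bsub>GM\<^esub> C) j l)) \<in> {1..n} \<rightarrow> carrier (M i l)"
      by (intro gmat_mult_terms gmat_mult_closed A B C il)
    fix j
    assume j: "j \<in> {1..n}"
    show "(\<Oplus>\<^bsub>M i l\<^esub>k\<in>{1..n}. ?t j k) = emult i j l (A i j) ((B \<otimes>\<^bsub>GM\<^esub> C) j l)"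
      unfolding gmat_mult_entry[OF j il(2)]
      using il j
      by (intro abelian_group_hom.hom_finsum[OF emult_right_hom, symmetric] gmat_mult_terms B C c)
  qed
  finally show "((A \<otimes>\<^bsub>GM\<^esub> B) \<otimes>\<^bsub>GM\<^esub> C) i l = (A \<otimes>\<^bsub>GM\<^esub> (B \<otimes>\<^bsub>GM\<^esub> C)) i l"
    unfolding gmat_mult_entry[OF il, of A] .
qed

lemma emult_zero_left:
  "i \<in> {1..n} \<Longrightarrow> j \<in> {1..n} \<Longrightarrow> k \<in> {1..n} \<Longrightarrow> y \<in> carrier (M j k) \<Longrightarrow>
    emult i j k \<zero>\<^bsub>M i j\<^esub> y = \<zero>\<^bsub>M i k\<^esub>"
  by (rule abelian_group_hom.hom_zero[OF emult_left_hom])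

lemma emult_zero_right:
  "i \<in> {1..n} \<Longrightarrow> j \<in> {1..n} \<Longrightarrow> k \<in> {1..n} \<Longrightarrow> x \<in> carrier (M i j) \<Longrightarrow>
    emult i j k x \<zero>\<^bsub>M j k\<^esub> = \<zero>\<^bsub>M i k\<^esub>"
  by (rule abelian_group_hom.hom_zero[OF emult_right_hom])

lemma ring_gmat: "ring GM"
proof (rule ringI[OF abelian_group_gmat])
  show "monoid GM"
  proof (rule monoidI)
    fix A
    assume A: "A \<in> carrier GM"
    note c = gmat_entry_closed[OF A]
    show "\<one>\<^bsub>GM\<^esub> \<otimes>\<^bsub>GM\<^esub> A = A"
    proof (intro gmat_eqI gmat_mult_closed gmat_one_closed A)
      fix i k
      assume ik: "i \<in> {1..n}" "k \<in> {1..n}"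
      interpret ik: abelian_group "M i k"
        by (rule abelian_group_entry[OF ik])
      have "(\<one>\<^bsub>GM\<^esub> \<otimes>\<^bsub>GM\<^esub> A) i k = (\<Oplus>\<^bsub>M i k\<^esub>j\<in>{1..n}. if i = j then A j k else \<zero>\<^bsub>M i k\<^esub>)"
        unfolding gmat_mult_entry[OF ik] using ik c
        by (intro ik.finsum_cong') (auto simp: gmat_one_entry emult_one_left emult_zero_left)
      also have "\<dots> = A i k"
        using ik c by (subst ik.finsum_cong'[OF refl, where g = "\<lambda>j. if i = j then A i k else \<zero>\<^bsub>M i k\<^esub>"])
          (auto simp: ik.finsum_singleton)
      finally show "(\<one>\<^bsub>GM\<^esub> \<otimes>\<^bsub>GM\<^esub> A) i k = A i k" .
    qed
    show "A \<otimes>\<^bsub>GM\<^esub> \<one>\<^bsub>GM\<^esub> = A"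
    proof (intro gmat_eqI gmat_mult_closed gmat_one_closed A)
      fix i k
      assume ik: "i \<in> {1..n}" "k \<in> {1..n}"
      interpret ik: abelian_group "M i k"
        by (rule abelian_group_entry[OF ik])
      have "(A \<otimes>\<^bsub>GM\<^esub> \<one>\<^bsub>GM\<^esub>) i k = (\<Oplus>\<^bsub>M i k\<^esub>j\<in>{1..n}. if k = j then A i k else \<zero>\<^bsub>M i k\<^esub>)"
        unfolding gmat_mult_entry[OF ik] using ik c
        by (intro ik.finsum_cong') (auto simp: gmat_one_entry emult_one_right emult_zero_right)
      also have "\<dots> = A i k"
        using ik c by (simp add: ik.finsum_singleton)
      finally show "(A \<otimes>\<^bsub>GM\<^esub> \<one>\<^bsub>GM\<^esub>) i k = A i k" .
    qed
  qed (simp_all add: gmat_mult_closed gmat_one_closed gmat_mult_assoc)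
next
  fix A B C
  assume A: "A \<in> carrier GM" and B: "B \<in> carrier GM" and C: "C \<in> carrier GM"
  note c = gmat_entry_closed[OF A] gmat_entry_closed[OF B] gmat_entry_closed[OF C]
  show "(A \<oplus>\<^bsub>GM\<^esub> B) \<otimes>\<^bsub>GM\<^esub> C = A \<otimes>\<^bsub>GM\<^esub> C \<oplus>\<^bsub>GM\<^esub> B \<otimes>\<^bsub>GM\<^esub> C"
  proof (intro gmat_eqI gmat_mult_closed gmat_add_closed A B C)
    fix i k
    assume ik: "i \<in> {1..n}" "k \<in> {1..n}"
    interpret ik: abelian_group "M i k"
      by (rule abelian_group_entry[OF ik])
    have "((A \<oplus>\<^bsub>GM\<^esub> B) \<otimes>\<^bsub>GM\<^esub> C) i k = (\<Oplus>\<^bsub>M i k\<^esub>j\<in>{1..n}.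
        emult i j k (A i j) (C j k) \<oplus>\<^bsub>M i k\<^esub> emult i j k (B i j) (C j k))"
      unfolding gmat_mult_entry[OF ik] using ik c
      by (intro ik.finsum_cong') (auto simp: gmat_add_entry emult_closed
          abelian_group_hom.hom_add[OF emult_left_hom])
    also have "\<dots> = (A \<otimes>\<^bsub>GM\<^esub> C \<oplus>\<^bsub>GM\<^esub> B \<otimes>\<^bsub>GM\<^esub> C) i k"
      unfolding gmat_add_entry[OF ik] gmat_mult_entry[OF ik]
      by (intro ik.finsum_addf gmat_mult_terms A B C ik)
    finally show "((A \<oplus>\<^bsub>GM\<^esub> B) \<otimes>\<^bsub>GM\<^esub> C) i k = (A \<otimes>\<^bsub>GM\<^esub> C \<oplus>\<^bsub>GM\<^esub> B \<otimes>\<^bsub>GM\<^esub> C) i k" .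
  qed
  show "C \<otimes>\<^bsub>GM\<^esub> (A \<oplus>\<^bsub>GM\<^esub> B) = C \<otimes>\<^bsub>GM\<^esub> A \<oplus>\<^bsub>GM\<^esub> C \<otimes>\<^bsub>GM\<^esub> B"
  proof (intro gmat_eqI gmat_mult_closed gmat_add_closed A B C)
    fix i k
    assume ik: "i \<in> {1..n}" "k \<in> {1..n}"
    interpret ik: abelian_group "M i k"
      by (rule abelian_group_entry[OF ik])
    have "(C \<otimes>\<^bsub>GM\<^esub> (A \<oplus>\<^bsub>GM\<^esub> B)) i k = (\<Oplus>\<^bsub>M i k\<^esub>j\<in>{1..n}.
        emult i j k (C i j) (A j k) \<oplus>\<^bsub>M i k\<^esub> emult i j k (C i j) (B j k))"
      unfolding gmat_mult_entry[OF ik] using ik c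
      by (intro ik.finsum_cong') (auto simp: gmat_add_entry emult_closed
          abelian_group_hom.hom_add[OF emult_right_hom])
    also have "\<dots> = (C \<otimes>\<^bsub>GM\<^esub> A \<oplus>\<^bsub>GM\<^esub> C \<otimes>\<^bsub>GM\<^esub> B) i k"
      unfolding gmat_add_entry[OF ik] gmat_mult_entry[OF ik]
      by (intro ik.finsum_addf gmat_mult_terms A B C ik)
    finally show "(C \<otimes>\<^bsub>GM\<^esub> (A \<oplus>\<^bsub>GM\<^esub> B)) i k = (C \<otimes>\<^bsub>GM\<^esub> A \<oplus>\<^bsub>GM\<^esub> C \<otimes>\<^bsub>GM\<^esub> B) i k" .
  qed
qed

end

section \<open>Trivial pairings: the diagonal as a retract\<close>

context class_T
begin

lemma emult_back_and_forth:
  assumes "i \<in> {1..n}" "j \<in> {1..n}" "i \<noteq> j" "x \<in> carrier (M i j)" "y \<in> carrier (M j i)"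
  shows "emult i j i x y = \<zero>\<^bsub>M i i\<^esub>"
  unfolding entry_mult_def using assms
  by (intro trivial_theta bimodule_pair.pure_tensor_closed[OF bimodule_pair_entry])

text \<open>
  In \<open>\<Sum>\<^sub>j A\<^sub>i\<^sub>j B\<^sub>j\<^sub>i\<close> only \<open>j = i\<close> survives. This is why taking the diagonal is multiplicative.
\<close>

lemma gmat_mult_diagonal_entry:
  assumes A: "A \<in> carrier GM" and B: "B \<in> carrier GM" and i: "i \<in> {1..n}"
  shows "(A \<otimes>\<^bsub>GM\<^esub> B) i i = emult i i i (A i i) (B i i)"
proof -
  interpret ii: abelian_group "M i i"
    by (rule abelian_group_entry[OF i i])
  note c = gmat_entry_closed[OF A] gmat_entry_closed[OF B]
  have "(A \<otimes>\<^bsub>GM\<^esub> B) i i =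
      (\<Oplus>\<^bsub>M i i\<^esub>j\<in>{1..n}. if i = j then emult i i i (A i i) (B i i) else \<zero>\<^bsub>M i i\<^esub>)"
    unfolding gmat_mult_entry[OF i i] using i
    by (intro ii.finsum_cong') (auto intro!: emult_back_and_forth emult_closed c)
  also have "\<dots> = emult i i i (A i i) (B i i)"
    using i by (simp add: ii.finsum_singleton emult_closed c)
  finally show ?thesis .
qed

definition diag :: "(nat \<Rightarrow> nat \<Rightarrow> 'a) \<Rightarrow> nat \<Rightarrow> nat \<Rightarrow> 'a" where
  "diag A = (\<lambda>i\<in>{1..n}. \<lambda>j\<in>{1..n}. if i = j then A i j else \<zero>\<^bsub>M i j\<^esub>)"

lemma diag_entry:
  "i \<in> {1..n} \<Longrightarrow> j \<in> {1..n} \<Longrightarrow> diag A i j = (if i = j then A i j else \<zero>\<^bsub>M i j\<^esub>)"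
  by (simp add: diag_def)

lemma zero_entry_closed: "i \<in> {1..n} \<Longrightarrow> j \<in> {1..n} \<Longrightarrow> \<zero>\<^bsub>M i j\<^esub> \<in> carrier (M i j)"
  by (intro abelian_monoid.zero_closed abelian_group.axioms(1) abelian_group_entry)

lemma diag_closed: "A \<in> carrier GM \<Longrightarrow> diag A \<in> carrier GM"
  using gmat_entry_closed[of A] zero_entry_closed
  by (auto simp: diag_def gmat_ring_def PiE_iff)

lemma diagonal_mult_off_diagonal:
  assumes "A \<in> carrier GM" "B \<in> carrier GM" and ik: "i \<in> {1..n}" "k \<in> {1..n}" "i \<noteq> k"
  shows "(diag A \<otimes>\<^bsub>GM\<^esub> diag B) i k = \<zero>\<^bsub>M i k\<^esub>"
proof -
  interpret ik: abelian_group "M i k"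
    by (rule abelian_group_entry[OF ik(1,2)])
  have "emult i j k (diag A i j) (diag B j k) = \<zero>\<^bsub>M i k\<^esub>" if "j \<in> {1..n}" for j
    using that ik assms(1,2)
    by (cases "i = j")
      (simp_all add: diag_entry emult_zero_left emult_zero_right gmat_entry_closed zero_entry_closed)
  then show ?thesis
    unfolding gmat_mult_entry[OF ik(1,2)] by (intro ik.add.finprod_one_eqI)
qed

lemma diag_ring_hom: "diag \<in> ring_hom GM GM"
proof (rule ring_hom_memI)
  fix A B
  assume A: "A \<in> carrier GM" and B: "B \<in> carrier GM"
  show "diag (A \<otimes>\<^bsub>GM\<^esub> B) = diag A \<otimes>\<^bsub>GM\<^esub> diag B"
  proof (intro gmat_eqI gmat_mult_closed diag_closed A B)
    fix i k
    assume ik: "i \<in> {1..n}" "k \<in> {1..n}"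
    show "diag (A \<otimes>\<^bsub>GM\<^esub> B) i k = (diag A \<otimes>\<^bsub>GM\<^esub> diag B) i k"
    proof (cases "i = k")
      case True
      then show ?thesis
        using ik A B by (simp add: diag_entry gmat_mult_diagonal_entry diag_closed)
    next
      case False
      then show ?thesis
        using ik A B by (simp add: diag_entry diagonal_mult_off_diagonal)
    qed
  qed
  have zero: "\<zero>\<^bsub>M i j\<^esub> = \<zero>\<^bsub>M i j\<^esub> \<oplus>\<^bsub>M i j\<^esub> \<zero>\<^bsub>M i j\<^esub>" if "i \<in> {1..n}" "j \<in> {1..n}" for i j
    by (intro abelian_monoid.l_zero[symmetric] abelian_group.axioms(1) abelian_group_entry
        zero_entry_closed that)
  show "diag (A \<oplus>\<^bsub>GM\<^esub> B) = diag A \<oplus>\<^bsub>GM\<^esub> diag B"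
    by (intro gmat_eqI gmat_add_closed diag_closed A B)
      (simp add: diag_entry gmat_add_entry zero[symmetric])
next
  show "diag \<one>\<^bsub>GM\<^esub> = \<one>\<^bsub>GM\<^esub>"
    by (intro gmat_eqI gmat_one_closed diag_closed) (simp add: diag_entry gmat_one_entry)
qed (rule diag_closed)

abbreviation "DM \<equiv> diagonal_subring n R M \<theta>"

text \<open>
  As the image of a ring endomorphism, the set of diagonal matrices is a ring.
\<close>

lemma DM_image: "DM = GM\<lparr>carrier := diag ` carrier GM\<rparr>"
proof -
  have "A = diag A" if "A \<in> carrier GM" "\<forall>i\<in>{1..n}. \<forall>j\<in>{1..n}. i \<noteq> j \<longrightarrow> A i j = \<zero>\<^bsub>M i j\<^esub>" for A
    using that by (intro gmat_eqI diag_closed) (auto simp: diag_entry)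
  then have "{A \<in> carrier GM. \<forall>i\<in>{1..n}. \<forall>j\<in>{1..n}. i \<noteq> j \<longrightarrow> A i j = \<zero>\<^bsub>M i j\<^esub>} =
      diag ` carrier GM"
    by (auto simp: diag_closed diag_entry)
  then show ?thesis
    by (simp add: diagonal_subring_def)
qed

lemma diag_idempotent: "A \<in> carrier GM \<Longrightarrow> diag (diag A) = diag A"
  by (intro gmat_eqI diag_closed) (simp_all add: diag_entry)

text \<open>
  An \<open>(i, k)\<close> entry of a product of off-diagonal matrices is a sum over paths
  \<open>i = i\<^sub>0, i\<^sub>1, \<dots>, i\<^sub>m = k\<close> whose consecutive vertices differ. The element \<open>x\<close> stands for the product along
  the part of a path from \<open>i\<close> to \<open>j\<close> already travelled, and \<open>F\<close> for the vertices it has left. From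
  there on a return to \<open>f \<in> F\<close> gives zero: the stretch from \<open>f\<close> back to \<open>f\<close> factors through
  \<open>M\<^sub>f\<^sub>g M\<^sub>g\<^sub>f = 0\<close>, where \<open>g \<noteq> f\<close> is the vertex after \<open>f\<close>. Every step from a vertex outside \<open>F\<close> enlarges
  \<open>F\<close>, and once \<open>F\<close> contains all \<open>n\<close> vertices, every end point \<open>k\<close> is a return.
\<close>

lemma off_diagonal_path_vanishes:
  assumes "i \<in> {1..n}" "k \<in> {1..n}"
    and "\<And>A. A \<in> set As \<Longrightarrow> A \<in> carrier GM \<and> (\<forall>i\<in>{1..n}. A i i = \<zero>\<^bsub>M i i\<^esub>)"
    and "j \<in> {1..n}" "x \<in> carrier (M i j)"
    and "F \<subseteq> {1..n}" "\<And>f y. f \<in> F \<Longrightarrow> y \<in> carrier (M j f) \<Longrightarrow> emult i j f x y = \<zero>\<^bsub>M i f\<^esub>"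
    and "n \<le> card F + length As"
  shows "emult i j k x (list_prod GM As j k) = \<zero>\<^bsub>M i k\<^esub>"
  using assms(3-)
proof (induction As arbitrary: j x F)
  case Nil
  have "F = {1..n}"
    using Nil.prems by (intro card_seteq) auto
  then show ?case
    using Nil.prems assms(2) gmat_entry_closed[OF gmat_one_closed] by simp
next
  case (Cons A As)
  interpret G: ring GM
    by (rule ring_gmat)
  interpret ik: abelian_group "M i k"
    by (rule abelian_group_entry[OF assms(1,2)])
  let ?P = "list_prod GM As"
  note ijk = assms(1) \<open>j \<in> {1..n}\<close> assms(2)
  have A: "A \<in> carrier GM" "\<And>i. i \<in> {1..n} \<Longrightarrow> A i i = \<zero>\<^bsub>M i i\<^esub>"
    using Cons.prems(1) by auto
  have P: "?P \<in> carrier GM"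
    using Cons.prems(1) by (intro G.list_prod_closed) auto
  note c = gmat_entry_closed[OF A(1)] gmat_entry_closed[OF P]
  show ?case
  proof (cases "j \<in> F")
    case True
    \<comment> \<open>A path that has just returned to \<open>F\<close>: its product \<open>x = x \<one>\<close> is itself zero.\<close>
    have "x = emult i j j x \<one>\<^bsub>R j\<^esub>"
      using ijk Cons.prems(3) by (simp add: emult_one_right)
    also have "\<dots> = \<zero>\<^bsub>M i j\<^esub>"
      using ijk True by (intro Cons.prems(5) unit_in_entry)
    finally show ?thesis
      using ijk gmat_entry_closed[OF gmat_mult_closed[OF A(1) P]] by (simp add: emult_zero_left)
  next
    case False
    have "emult i j k x (emult j l k (A j l) (?P l k)) = \<zero>\<^bsub>M i k\<^esub>" if l: "l \<in> {1..n}" for l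
    proof (cases "l = j")
      case True
      then show ?thesis
        using ijk Cons.prems(3) by (simp add: A(2) emult_zero_left emult_zero_right c)
    next
      case False
      let ?x = "emult i j l x (A j l)"
      have x: "?x \<in> carrier (M i l)"
        using ijk l Cons.prems(3) by (intro emult_closed c)
      have "emult i l k ?x (?P l k) = \<zero>\<^bsub>M i k\<^esub>"
      proof (rule Cons.IH[OF _ l x])
        show "insert j F \<subseteq> {1..n}"
          using Cons.prems ijk by simp
        show "n \<le> card (insert j F) + length As"
          using Cons.prems(4,6) \<open>j \<notin> F\<close> finite_subset[OF Cons.prems(4)] by simp
        fix f y
        assume f: "f \<in> insert j F" and y: "y \<in> carrier (M l f)"
        have f': "f \<in> {1..n}"
          using f ijk Cons.prems(4) by blast
        have "emult i l f ?x y = emult i j f x (emult j l f (A j l) y)"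
          using ijk l f' y Cons.prems(3) by (intro entry_mult_assoc c)
        also have "\<dots> = \<zero>\<^bsub>M i f\<^esub>"
        proof (cases "f = j")
          case True
          then show ?thesis
            using ijk l y Cons.prems(3) False
            by (simp add: emult_back_and_forth emult_zero_right c)
        next
          case False
          then show ?thesis
            using f f' ijk l y by (intro Cons.prems(5) emult_closed c) simp_all
        qed
        finally show "emult i l f ?x y = \<zero>\<^bsub>M i f\<^esub>" .
      qed (use Cons.prems(1) in auto)
      then show ?thesis
        using ijk l Cons.prems(3) by (simp add: entry_mult_assoc c)
    qed
    then have "(\<Oplus>\<^bsub>M i k\<^esub>l\<in>{1..n}. emult i j k x (emult j l k (A j l) (?P l k))) = \<zero>\<^bsub>M i k\<^esub>"
      by (intro ik.add.finprod_one_eqI)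
    moreover have "emult i j k x ((A \<otimes>\<^bsub>GM\<^esub> ?P) j k) =
        (\<Oplus>\<^bsub>M i k\<^esub>l\<in>{1..n}. emult i j k x (emult j l k (A j l) (?P l k)))"
      unfolding gmat_mult_entry[OF ijk(2,3)] using ijk Cons.prems(3)
      by (intro abelian_group_hom.hom_finsum[OF emult_right_hom] gmat_mult_terms A P)
    ultimately show ?thesis
      by simp
  qed
qed

lemma off_diagonal_nilpotent:
  assumes As: "\<And>A. A \<in> set As \<Longrightarrow> A \<in> carrier GM \<and> (\<forall>i\<in>{1..n}. A i i = \<zero>\<^bsub>M i i\<^esub>)"
    and len: "length As = n"
  shows "list_prod GM As = \<zero>\<^bsub>GM\<^esub>"
proof -
  interpret G: ring GM
    by (rule ring_gmat)
  have P: "list_prod GM As \<in> carrier GM"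
    using As by (intro G.list_prod_closed) auto
  show ?thesis
  proof (intro gmat_eqI P gmat_zero_closed)
    fix i k
    assume ik: "i \<in> {1..n}" "k \<in> {1..n}"
    have "emult i i k \<one>\<^bsub>R i\<^esub> (list_prod GM As i k) = \<zero>\<^bsub>M i k\<^esub>"
      by (rule off_diagonal_path_vanishes[OF ik As ik(1) unit_in_entry[OF ik(1)], where F = "{}"])
        (use len in auto)
    then show "list_prod GM As i k = \<zero>\<^bsub>GM\<^esub> i k"
      using ik by (simp add: emult_one_left gmat_entry_closed[OF P] gmat_zero_entry)
  qed
qed

lemma split_nilpotent_extension_gmat: "split_nilpotent_extension GM DM diag (\<lambda>A. A) n"
proof -
  interpret endo: ring_hom_ring GM GM diag
    by (intro ring_hom_ring.intro ring_hom_ring_axioms.intro ring_gmat diag_ring_hom)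
  have ring_DM: "ring DM"
    unfolding DM_image by (rule endo.img_is_ring)
  interpret diag: ring_hom_ring GM DM diag
    using diag_ring_hom
    by (intro ring_hom_ring.intro ring_hom_ring_axioms.intro ring_gmat ring_DM)
      (auto simp: ring_hom_def DM_image)
  show ?thesis
  proof
    show "(\<lambda>A. A) \<in> ring_hom DM GM"
      by (rule ring_hom_memI) (auto simp: DM_image diag_closed)
    show "diag A = A" if "A \<in> carrier DM" for A
      using that by (auto simp: DM_image diag_idempotent)
    show "list_prod GM As = \<zero>\<^bsub>GM\<^esub>" if As: "set As \<subseteq> a_kernel GM DM diag" "length As = n" for As
    proof (rule off_diagonal_nilpotent[OF _ As(2)])
      fix A
      assume "A \<in> set As"
      then have "A \<in> a_kernel GM DM diag"
        using As(1) by blast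
      moreover have "\<zero>\<^bsub>DM\<^esub> = \<zero>\<^bsub>GM\<^esub>"
        by (simp add: DM_image)
      ultimately have A: "A \<in> carrier GM" "diag A = \<zero>\<^bsub>GM\<^esub>"
        unfolding a_kernel_def' by simp_all
      have "A i i = \<zero>\<^bsub>M i i\<^esub>" if i: "i \<in> {1..n}" for i
        using fun_cong[OF fun_cong[OF A(2)], of i i] i by (simp add: diag_entry gmat_zero_entry)
      then show "A \<in> carrier GM \<and> (\<forall>i\<in>{1..n}. A i i = \<zero>\<^bsub>M i i\<^esub>)"
        using A by blast
    qed
  qed (use size_pos in auto)
qed

end

theorem corollary2p6:
  fixes n :: nat
    and R :: "nat \<Rightarrow> 'a ring"
    and M :: "nat \<Rightarrow> nat \<Rightarrow> ('a, 'a, 'a) bimodule"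
    and \<theta> :: "nat \<Rightarrow> nat \<Rightarrow> nat \<Rightarrow> ('a \<times> 'a \<Rightarrow>\<^sub>0 int) set \<Rightarrow> 'a"
  assumes "class_T n R M \<theta>"
  shows "(semilocal (diagonal_subring n R M \<theta>) \<longleftrightarrow> semilocal (gmat_ring n R M \<theta>)) \<and>
         (semiperfect (diagonal_subring n R M \<theta>) \<longleftrightarrow> semiperfect (gmat_ring n R M \<theta>)) \<and>
         (left_perfect (diagonal_subring n R M \<theta>) \<longleftrightarrow> left_perfect (gmat_ring n R M \<theta>)) \<and>
         (right_perfect (diagonal_subring n R M \<theta>) \<longleftrightarrow> right_perfect (gmat_ring n R M \<theta>)) \<and>
         (semiprimary (diagonal_subring n R M \<theta>) \<longleftrightarrow> semiprimary (gmat_ring n R M \<theta>)) \<and>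
         (bounded_index (diagonal_subring n R M \<theta>) \<longleftrightarrow> bounded_index (gmat_ring n R M \<theta>))"
proof -
  interpret split_nilpotent_extension "gmat_ring n R M \<theta>" "diagonal_subring n R M \<theta>"
    "class_T.diag n M" "\<lambda>A. A" n
    by (rule class_T.split_nilpotent_extension_gmat[OF assms])
  show ?thesis
    by (intro conjI semilocal_iff semiperfect_iff left_perfect_iff right_perfect_iff
        semiprimary_iff bounded_index_iff)
qed

end
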